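(* Let $t>3$. The incidence structure $\mathcal{H}$ is a $2$-$\left(\frac{q^t-1}{q-1},q+1,1\right)$ design, isomorphic to the design of points and lines of $\mathrm{PG}(t-1,q)$.
   Context: Let $q$ be a prime power. In $\mathrm{PG}(t-1,q^t)$ let $\sigma$ be the collineation $\langle(x_0,\dots,x_{t-1})\rangle\mapsto\langle(x_{t-1}^q,x_0^q,\dots,x_{t-2}^q)\rangle$, whose fixed points form a subgeometry $\pi\cong\mathrm{PG}(t-1,q)$, and let $R=\langle(1,0,\dots,0)\rangle$, so that $R,R^\sigma,\dots,R^{\sigma^{t-1}}$ span $\mathrm{PG}(t-1,q^t)$. For each divisor $s>1$ of $t$, let $\Lambda_s$ be the set of points fixed by $\sigma^s$ and $\Pi_s=\langle R,R^{\sigma^s},\dots,R^{\sigma^{t-s}}\rangle\cap\Lambda_s$; the spaces $\Pi_s,\Pi_s^\sigma,\dots,\Pi_s^{\sigma^{s-1}}$ are the indicator spaces of a Desarguesian $(s-1)$-spread $\mathcal{D}_s$ of $\pi$ whose elements are $\langle X,X^\sigma,\dots,X^{\sigma^{s-1}}\rangle\cap\pi$, $X\in\Pi_s$ ($\mathcal{D}_t=\{\pi\}$ with indicator points $R,\dots,R^{\sigma^{t-1}}$). For $D\in\mathcal{D}_s$, $\overline{D}$ is its extension to $\mathrm{PG}(t-1,q^t)$. The incidence structure $\mathcal{H}$: its points are the points of $\pi$; for distinct points $P,Q$ of $\pi$, let $s$ be the smallest divisor of $t$ such that $P,Q$ lie in a common element $D$ of $\mathcal{D}_s$; the unique block through $P$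 and $Q$ is the set of points of $\pi$ lying on the normal rational curve of degree $s-1$ through $P$, $Q$ and the intersection points of $\overline{D}$ with $\Pi_s,\Pi_s^\sigma,\dots,\Pi_s^{\sigma^{s-1}}$; incidence is containment. *)

theory Defs
  imports "Jordan_Normal_Form.VS_Connect" "HOL-Number_Theory.Prime_Powers"
begin

section \<open>Projective spaces\<close>

text \<open>A point of \<open>PG(n - 1, K)\<close> is a one-dimensional subspace of \<open>K\<^sup>n\<close>, taken as its set of
  vectors (so the zero vector belongs to every point). A projective subspace is its set of points.\<close>

definition vec_span :: "nat \<Rightarrow> 'a::field vec set \<Rightarrow> 'a vec set" where
  "vec_span n S = LinearCombinations.module.span class_ring (module_vec TYPE('a) n) S"

definition pg_point :: "nat \<Rightarrow> 'a::field vec \<Rightarrow> 'a vec set" where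
  "pg_point n v = vec_span n {v}"

definition pg_points :: "nat \<Rightarrow> 'a::field vec set set" where
  "pg_points n = {pg_point n v | v. v \<in> carrier_vec n \<and> v \<noteq> 0\<^sub>v n}"

definition pg_span :: "nat \<Rightarrow> 'a::field vec set set \<Rightarrow> 'a vec set set" where
  "pg_span n S = {P \<in> pg_points n. P \<subseteq> vec_span n (\<Union>S)}"

definition pg_lines :: "nat \<Rightarrow> 'a::field vec set set set" where
  "pg_lines n = {pg_span n {P, Q} | P Q. P \<in> pg_points n \<and> Q \<in> pg_points n \<and> P \<noteq> Q}"

text \<open>A normal rational curve of degree \<open>d\<close> is the image of the standard one,
  \<open>{\<langle>(u\<^sup>d, u\<^sup>d\<^sup>-\<^sup>1v, \<dots>, v\<^sup>d)\<rangle> | (u, v) \<noteq> (0, 0)}\<close> in \<open>PG(d, K)\<close>, under a linear embedding of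
  \<open>PG(d, K)\<close> into \<open>PG(n - 1, K)\<close>. For \<open>d = 1\<close> these are the lines.\<close>

definition normal_rational_curve :: "nat \<Rightarrow> nat \<Rightarrow> 'a::field vec set set \<Rightarrow> bool" where
  "normal_rational_curve n d C \<longleftrightarrow>
     (\<exists>A \<in> carrier_mat n (d + 1).
        inj_on (\<lambda>v. A *\<^sub>v v) (carrier_vec (d + 1)) \<and>
        C = {pg_point n (A *\<^sub>v vec (d + 1) (\<lambda>i. u ^ (d - i) * v ^ i)) | u v. (u, v) \<noteq> (0, 0)})"


section \<open>Designs\<close>

text \<open>Incidence is membership, so a structure is a point set together with a set of blocks.\<close>

definition is_2_design :: "nat \<Rightarrow> nat \<Rightarrow> nat \<Rightarrow> 'p set \<Rightarrow> 'p set set \<Rightarrow> bool" where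
  "is_2_design v k l X Bs \<longleftrightarrow>
     finite X \<and> card X = v \<and>
     (\<forall>B \<in> Bs. B \<subseteq> X \<and> card B = k) \<and>
     (\<forall>x \<in> X. \<forall>y \<in> X. x \<noteq> y \<longrightarrow> card {B \<in> Bs. x \<in> B \<and> y \<in> B} = l)"

definition design_iso :: "'p set \<Rightarrow> 'p set set \<Rightarrow> 'r set \<Rightarrow> 'r set set \<Rightarrow> bool" where
  "design_iso X Bs Y Cs \<longleftrightarrow> (\<exists>f. bij_betw f X Y \<and> (\<lambda>B. f ` B) ` Bs = Cs)"


section \<open>The subgeometry, its Desarguesian spreads, and the structure \<open>\<H>\<close>\<close>

text \<open>Throughout, the field \<open>'a\<close> is meant to have \<open>q\<^sup>t\<close> elements.\<close>

definition frob_shift :: "nat \<Rightarrow> nat \<Rightarrow> 'a::field vec \<Rightarrow> 'a vec" where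
  "frob_shift q t x = vec t (\<lambda>i. (x $ ((i + t - 1) mod t)) ^ q)"

definition sigma :: "nat \<Rightarrow> nat \<Rightarrow> 'a::field vec set \<Rightarrow> 'a vec set" where
  "sigma q t P = frob_shift q t ` P"

definition subgeom :: "nat \<Rightarrow> nat \<Rightarrow> 'a::field vec set set" where
  "subgeom q t = {P \<in> pg_points t. sigma q t P = P}"

definition R_point :: "nat \<Rightarrow> 'a::field vec set" where
  "R_point t = pg_point t (unit_vec t 0)"

definition Lambda_set :: "nat \<Rightarrow> nat \<Rightarrow> nat \<Rightarrow> 'a::field vec set set" where
  "Lambda_set q t s = {P \<in> pg_points t. (sigma q t ^^ s) P = P}"

definition Pi_space :: "nat \<Rightarrow> nat \<Rightarrow> nat \<Rightarrow> 'a::field vec set set" where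
  "Pi_space q t s =
     pg_span t {(sigma q t ^^ (s * k)) (R_point t) | k. k < t div s} \<inter> Lambda_set q t s"

definition spread :: "nat \<Rightarrow> nat \<Rightarrow> nat \<Rightarrow> 'a::field vec set set set" where
  "spread q t s =
     {pg_span t {(sigma q t ^^ i) X | i. i < s} \<inter> subgeom q t | X. X \<in> Pi_space q t s}"

definition min_divisor :: "nat \<Rightarrow> nat \<Rightarrow> 'a::field vec set \<Rightarrow> 'a vec set \<Rightarrow> nat" where
  "min_divisor q t P Q =
     (LEAST s. s > 1 \<and> s dvd t \<and> (\<exists>D \<in> spread q t s. P \<in> D \<and> Q \<in> D))"

text \<open>The extension of a subspace \<open>D\<close> of the subgeometry is its span over the large field.\<close>

definition indicator_points ::
    "nat \<Rightarrow> nat \<Rightarrow> nat \<Rightarrow> 'a::field vec set set \<Rightarrow> 'a vec set set" where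
  "indicator_points q t s D = (\<Union>i<s. pg_span t D \<inter> (sigma q t ^^ i) ` Pi_space q t s)"

text \<open>\<open>is_block_through q t P Q B\<close>: \<open>B\<close> consists of the points of the subgeometry on the normal
  rational curve determined by \<open>P\<close> and \<open>Q\<close>. The spread element \<open>D\<close> and the curve \<open>C\<close>, which are
  unique in the intended setting, are bound existentially rather than by a description operator,
  so no junk value can enter, and a second admissible curve would only yield further blocks.\<close>

definition is_block_through ::
    "nat \<Rightarrow> nat \<Rightarrow> 'a::field vec set \<Rightarrow> 'a vec set \<Rightarrow> 'a vec set set \<Rightarrow> bool" where
  "is_block_through q t P Q B \<longleftrightarrow>
     (let s = min_divisor q t P Q in
      \<exists>D \<in> spread q t s. P \<in> D \<and> Q \<in> D \<and>
        (\<exists>C. normal_rational_curve t (s - 1) C \<and> P \<in> C \<and> Q \<in> C \<and>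
             indicator_points q t s D \<subseteq> C \<and> B = C \<inter> subgeom q t))"

definition H_blocks :: "nat \<Rightarrow> nat \<Rightarrow> 'a::field vec set set set" where
  "H_blocks q t =
     {B. \<exists>P \<in> subgeom q t. \<exists>Q \<in> subgeom q t. P \<noteq> Q \<and> is_block_through q t P Q B}"

end

theory Submission
  imports Defs "Jordan_Normal_Form.Char_Poly" "HOL-Algebra.Multiplicative_Group" "HOL-Number_Theory.Residues"
begin

text \<open>Let \<open>K\<close> be the field with \<open>q\<^sup>t\<close> elements. By Hilbert 90 the points of the subgeometry are the
  \<open>P\<^sub>a = \<langle>(a, a\<^sup>q, a\<^sup>q\<^sup>q, \<dots>)\<rangle>\<close> with \<open>a \<noteq> 0\<close>, and \<open>P\<^sub>a\<close> and \<open>P\<^sub>b\<close> lie in a common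
  element of the spread with parameter \<open>s\<close> iff \<open>a / b\<close> lies in the subfield with \<open>q\<^sup>s\<close> elements; for
  minimal \<open>s\<close> the first \<open>s\<close> conjugates of \<open>a / b\<close> are distinct. A normal rational curve through
  the indicator points is \<open>\<langle>(k\<^sub>m \<Prod>\<^sub>i L\<^sub>i(u, v) / L\<^sub>m(u, v))\<^sub>m\<rangle>\<close> for linear forms \<open>L\<^sub>i\<close>, indices being
  read modulo \<open>s\<close>. Prescribing the two points \<open>P\<^bsub>1/w\<^esub>\<close> and \<open>P\<^bsub>1/w'\<^esub>\<close> on it turns its points of the
  subgeometry into the \<open>P\<^bsub>1/(A w + B w')\<^esub>\<close> with \<open>A\<close>, \<open>B\<close> in the field with \<open>q\<close> elements. So
  \<open>P\<^sub>a \<mapsto> \<langle>1 / a\<rangle>\<close> maps the blocks to the lines of \<open>K\<close>, regarded as a \<open>t\<close>-dimensional vector space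
  over that field.\<close>

section \<open>Spans and projective subspaces\<close>

text \<open>Dividing a point of the curve by the product of all \<open>L_i\<close> leaves the
  coordinates \<open>k_m / L_m\<close>. So coordinatewise inversion carries the curve to a line, and
  it respects the subgeometry because inversion commutes with conjugation; this is why
  \<open>1 / a\<close> linearises the blocks, whatever \<open>s\<close> is. Distinctness of the
  conjugates keeps the forms \<open>L_i\<close> pairwise independent. Three obstacles shape the
  proof. A block may come from any admissible curve, so one curve has to be produced and every other
  one has to be shown to give the same block; the constants \<open>k_m\<close> of an arbitrary curve
  are unknown and must cancel. The curve is tied only to those indicator points that lie in the
  extension of the spread element, so the subgeometry points of that element must be shown to span
  all \<open>s\<close> of them. Finally, the target space is over a separate field with
  \<open>q\<close> elements, which first has to be embedded into \<open>K\<close>.\<close>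

definition closed_subspace :: "nat \<Rightarrow> 'a::field vec set \<Rightarrow> bool" where
  "closed_subspace n W \<longleftrightarrow> W \<subseteq> carrier_vec n \<and> 0\<^sub>v n \<in> W \<and>
     (\<forall>x\<in>W. \<forall>y\<in>W. x + y \<in> W) \<and> (\<forall>c. \<forall>x\<in>W. c \<cdot>\<^sub>v x \<in> W)"

lemma closed_subspace_vec_span:
  assumes "S \<subseteq> carrier_vec n"
  shows "closed_subspace n (vec_span n S)"
proof -
  interpret V: vec_space "TYPE('a)" n .
  show ?thesis
    unfolding closed_subspace_def vec_span_def
    using assms V.span_is_subset2[of S] V.span_zero[of S] V.span_add1[of S] V.smult_in_span[of S]
    by (auto simp: subset_iff)
qed

lemma vec_span_superset:
  assumes "S \<subseteq> carrier_vec n"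
  shows "S \<subseteq> vec_span n S"
proof -
  interpret V: vec_space "TYPE('a)" n .
  show ?thesis
    unfolding vec_span_def using assms V.in_own_span by simp
qed

lemma vec_span_minimal:
  assumes "closed_subspace n W" "S \<subseteq> W"
  shows "vec_span n S \<subseteq> W"
proof -
  interpret V: vec_space "TYPE('a)" n .
  have "LinearCombinations.submodule class_ring W V.V"
    using assms(1)
    unfolding LinearCombinations.submodule_def closed_subspace_def module_vec_def
    using V.module_axioms by (auto simp: module_vec_def)
  then show ?thesis
    unfolding vec_span_def using assms V.span_is_subset by blast
qed

lemma closed_subspace_sum:
  assumes W: "closed_subspace n W" and "finite A" and "\<And>k. k \<in> A \<Longrightarrow> vec n (f k) \<in> W"
  shows "vec n (\<lambda>m. \<Sum>k\<in>A. c k * f k m) \<in> W"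
  using assms(2,3)
proof (induction A rule: finite_induct)
  case empty
  have "vec n (\<lambda>m. 0 :: 'a) = 0\<^sub>v n" by auto
  then show ?case using W by (simp add: closed_subspace_def)
next
  case (insert a A)
  have "vec n (\<lambda>m. \<Sum>k\<in>insert a A. c k * f k m)
      = c a \<cdot>\<^sub>v vec n (f a) + vec n (\<lambda>m. \<Sum>k\<in>A. c k * f k m)"
    using insert(1,2) by (intro eq_vecI) auto
  then show ?case using W insert by (auto simp: closed_subspace_def)
qed

lemma pg_point_eq:
  assumes "v \<in> carrier_vec n"
  shows "pg_point n v = {c \<cdot>\<^sub>v v | c. True}"
proof
  have W: "closed_subspace n {c \<cdot>\<^sub>v v | c. True}"
    unfolding closed_subspace_def
  proof (intro conjI ballI allI)
    show "0\<^sub>v n \<in> {c \<cdot>\<^sub>v v | c. True}"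
      using assms by (auto intro!: exI[of _ 0])
  qed (use assms in \<open>auto simp: smult_smult_assoc simp flip: add_smult_distrib_vec\<close>)
  have "v \<in> {c \<cdot>\<^sub>v v | c. True}"
    by (auto intro!: exI[of _ 1])
  then show "pg_point n v \<subseteq> {c \<cdot>\<^sub>v v | c. True}"
    unfolding pg_point_def by (intro vec_span_minimal[OF W]) auto
  have "{v} \<subseteq> carrier_vec n" using assms by simp
  from closed_subspace_vec_span[OF this] vec_span_superset[OF this]
  show "{c \<cdot>\<^sub>v v | c. True} \<subseteq> pg_point n v"
    unfolding pg_point_def closed_subspace_def by auto
qed

lemma self_in_pg_point: "v \<in> carrier_vec n \<Longrightarrow> v \<in> pg_point n v"
  by (auto simp: pg_point_eq intro!: exI[of _ 1])

lemma pg_point_subset_iff: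
  assumes "closed_subspace n W" "v \<in> carrier_vec n"
  shows "pg_point n v \<subseteq> W \<longleftrightarrow> v \<in> W"
  using assms self_in_pg_point[of v n] by (auto simp: pg_point_eq closed_subspace_def)

lemma pg_point_eq_iff:
  fixes v w :: "'a::field vec"
  assumes "v \<in> carrier_vec n" "w \<in> carrier_vec n" 
  shows "pg_point n v = pg_point n w \<longleftrightarrow> (\<exists>c. c \<noteq> 0 \<and> v = c \<cdot>\<^sub>v w)"
proof
  assume eq: "pg_point n v = pg_point n w"
  from eq self_in_pg_point[OF assms(1)] obtain c where c: "v = c \<cdot>\<^sub>v w"
    using assms by (auto simp: pg_point_eq)
  from eq self_in_pg_point[OF assms(2)] obtain d where d: "w = d \<cdot>\<^sub>v v"
    using assms by (auto simp: pg_point_eq)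
  show "\<exists>c. c \<noteq> 0 \<and> v = c \<cdot>\<^sub>v w"
  proof (cases "c = 0")
    \<comment> \<open>The scalar read off from membership may be 0, but then both vectors vanish and
      1 serves.\<close>
    case True
    then have "v = 0\<^sub>v n" using c assms by auto
    then have "v = 1 \<cdot>\<^sub>v w" using d by auto
    then show ?thesis by (intro exI[of _ 1]) simp
  qed (use c in blast)
next
  assume "\<exists>c. c \<noteq> 0 \<and> v = c \<cdot>\<^sub>v w"
  then obtain c where c: "c \<noteq> 0" "v = c \<cdot>\<^sub>v w" by blast
  have "\<exists>k. d \<cdot>\<^sub>v w = k \<cdot>\<^sub>v v" for d
    using c by (intro exI[of _ "d / c"]) (simp add: smult_smult_assoc)
  then show "pg_point n v = pg_point n w"
    unfolding pg_point_eq[OF assms(1)] pg_point_eq[OF assms(2)]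
    using c(2) by (auto simp: smult_smult_assoc)
qed

lemma pg_point_smult:
  assumes "v \<in> carrier_vec n" "c \<noteq> 0"
  shows "pg_point n (c \<cdot>\<^sub>v v) = pg_point n v"
  using assms by (subst pg_point_eq_iff) auto

lemma pg_points_iff:
  assumes "v \<in> carrier_vec n"
  shows "pg_point n v \<in> pg_points n \<longleftrightarrow> v \<noteq> 0\<^sub>v n"
proof
  assume "pg_point n v \<in> pg_points n"
  then obtain w where w: "w \<in> carrier_vec n" "w \<noteq> 0\<^sub>v n" "pg_point n w = pg_point n v"
    unfolding pg_points_def by auto
  then show "v \<noteq> 0\<^sub>v n" using pg_point_eq_iff[of w n v] assms by auto
qed (use assms in \<open>auto simp: pg_points_def\<close>)

text \<open>\<open>W\<close> enters through its universal property, so each use only has to guess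
  the span in coordinates and to expand its vectors in the generators.\<close>

lemma pg_span_eq:
  assumes "\<And>k. k \<in> I \<Longrightarrow> f k \<in> carrier_vec n" "\<And>k. k \<in> I \<Longrightarrow> f k \<in> W" "closed_subspace n W"
    and "\<And>U. closed_subspace n U \<Longrightarrow> f ` I \<subseteq> U \<Longrightarrow> W \<subseteq> U"
  shows "pg_span n ((\<lambda>k. pg_point n (f k)) ` I) = {P \<in> pg_points n. P \<subseteq> W}"
proof -
  have sub: "\<Union> ((\<lambda>k. pg_point n (f k)) ` I) \<subseteq> W"
    using assms(1-3) pg_point_subset_iff[OF assms(3)] by auto
  then have car: "\<Union> ((\<lambda>k. pg_point n (f k)) ` I) \<subseteq> carrier_vec n"
    using assms(3) unfolding closed_subspace_def by blast
  have "f ` I \<subseteq> vec_span n (\<Union> ((\<lambda>k. pg_point n (f k)) ` I))"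
    using vec_span_superset[OF car] self_in_pg_point assms(1) by blast
  then have "W \<subseteq> vec_span n (\<Union> ((\<lambda>k. pg_point n (f k)) ` I))"
    by (intro assms(4) closed_subspace_vec_span car)
  moreover have "vec_span n (\<Union> ((\<lambda>k. pg_point n (f k)) ` I)) \<subseteq> W"
    by (intro vec_span_minimal assms(3) sub)
  ultimately show ?thesis unfolding pg_span_def by auto
qed

lemma pg_span_two:
  fixes v w :: "'a::field vec"
  assumes "v \<in> carrier_vec n" "w \<in> carrier_vec n"
  shows "pg_span n {pg_point n v, pg_point n w}
    = {pg_point n (a \<cdot>\<^sub>v v + b \<cdot>\<^sub>v w) | a b. a \<cdot>\<^sub>v v + b \<cdot>\<^sub>v w \<noteq> 0\<^sub>v n}"
proof -
  let ?W = "{a \<cdot>\<^sub>v v + b \<cdot>\<^sub>v w | a b. True}"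
  have W: "closed_subspace n ?W"
    unfolding closed_subspace_def
  proof (intro conjI ballI allI)
    show "0\<^sub>v n \<in> ?W"
      using assms by (auto intro!: exI[of _ 0])
  next
    fix x y assume "x \<in> ?W" "y \<in> ?W"
    then obtain a b c d where "x = a \<cdot>\<^sub>v v + b \<cdot>\<^sub>v w" "y = c \<cdot>\<^sub>v v + d \<cdot>\<^sub>v w" by blast
    then have "x + y = (a + c) \<cdot>\<^sub>v v + (b + d) \<cdot>\<^sub>v w"
      using assms by (intro eq_vecI) (auto simp: algebra_simps)
    then show "x + y \<in> ?W" by blast
  next
    fix x c assume "x \<in> ?W"
    then obtain a b where "x = a \<cdot>\<^sub>v v + b \<cdot>\<^sub>v w" by blast
    then have "c \<cdot>\<^sub>v x = (c * a) \<cdot>\<^sub>v v + (c * b) \<cdot>\<^sub>v w"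
      using assms by (intro eq_vecI) (auto simp: algebra_simps)
    then show "c \<cdot>\<^sub>v x \<in> ?W" by blast
  qed (use assms in auto)
  have "v = 1 \<cdot>\<^sub>v v + 0 \<cdot>\<^sub>v w" "w = 0 \<cdot>\<^sub>v v + 1 \<cdot>\<^sub>v w"
    using assms by (auto intro!: eq_vecI)
  then have in_W: "v \<in> ?W" "w \<in> ?W" by blast+
  have "pg_span n ((\<lambda>k. pg_point n (id k)) ` {v, w}) = {P \<in> pg_points n. P \<subseteq> ?W}"
    by (rule pg_span_eq) (use assms W in_W in \<open>auto simp: closed_subspace_def\<close>)
  also have "\<dots> = {pg_point n x | x. x \<in> ?W \<and> x \<noteq> 0\<^sub>v n}"
  proof -
    have "?W \<subseteq> carrier_vec n" using W by (simp add: closed_subspace_def)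
    then show ?thesis
      using pg_point_subset_iff[OF W] unfolding pg_points_def by blast
  qed
  finally show ?thesis by auto
qed


section \<open>Finite fields\<close>

text \<open>A generator of the multiplicative group, stated with natural exponents so that no group
  structure has to be carried along.\<close>

definition primitive_elem :: "'a::field \<Rightarrow> bool" where
  "primitive_elem g \<longleftrightarrow> g \<noteq> 0 \<and> (\<forall>x. x \<noteq> 0 \<longrightarrow> (\<exists>k::nat. x = g ^ k))"

lemma ex_primitive_elem: "\<exists>g::'a::{field,finite}. primitive_elem g"
proof -
  let ?R = "class_ring :: 'a ring"
  have "finite (carrier ?R)" by simp
  from field.finite_field_mult_group_has_gen[OF class_field.field_axioms this]
  obtain g where g: "g \<in> carrier (mult_of ?R)"
    "carrier (mult_of ?R) = {g [^]\<^bsub>?R\<^esub> i | i::nat. i \<in> UNIV}" by (elim bexE)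
  have pow: "g [^]\<^bsub>?R\<^esub> (i::nat) = g ^ i" for i
    by (simp only: class_ring_simps)
  show ?thesis
  proof (rule exI[of _ g], unfold primitive_elem_def, intro conjI allI impI)
    show "g \<noteq> 0" using g(1) by simp
    fix x :: 'a assume "x \<noteq> 0"
    then have "x \<in> carrier (mult_of ?R)" by simp
    then show "\<exists>k. x = g ^ k" unfolding g(2) pow by blast
  qed
qed

text \<open>Multiplication by a nonzero \<open>x\<close> permutes the nonzero elements; comparing
  their product before and after gives the exponent.\<close>

lemma power_card_eq:
  fixes x :: "'a::{field,finite}"
  shows "x ^ card (UNIV :: 'a set) = x"
proof (cases "x = 0")
  case False
  have bij: "bij_betw (\<lambda>y. x * y) (UNIV - {0}) (UNIV - {0})"
    by (rule bij_betwI[of _ _ _ "\<lambda>y. y / x"]) (use False in auto)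
  have "(\<Prod>y\<in>UNIV - {0}. y) = (\<Prod>y\<in>UNIV - {0}. x * y)"
    using prod.reindex_bij_betw[OF bij, of "\<lambda>y. y"] by simp
  also have "\<dots> = x ^ (card (UNIV :: 'a set) - 1) * (\<Prod>y\<in>UNIV - {0}. y)"
    by (simp add: prod.distrib)
  finally have "x ^ (card (UNIV :: 'a set) - 1) = 1" by simp
  then have "x ^ Suc (card (UNIV :: 'a set) - 1) = x" by simp
  then show ?thesis
    using finite_UNIV_card_ge_0[where ?'a = 'a] by simp
qed (use finite_UNIV_card_ge_0[where ?'a = 'a] in simp)

lemma power_card_minus_1:
  fixes x :: "'a::{field,finite}"
  assumes "x \<noteq> 0"
  shows "x ^ (card (UNIV :: 'a set) - 1) = 1"
proof -
  have "x * x ^ (card (UNIV :: 'a set) - 1) = x ^ Suc (card (UNIV :: 'a set) - 1)" by simp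
  also have "\<dots> = x"
    using finite_UNIV_card_ge_0[where ?'a = 'a] power_card_eq[of x] by simp
  finally show ?thesis using assms by simp
qed

text \<open>If \<open>g ^ r = 1\<close> with \<open>r > 0\<close>, then \<open>g\<close> has at most
  \<open>r\<close> distinct powers, yet these must cover all nonzero elements.\<close>

lemma primitive_elem_power_eq_1_iff:
  fixes g :: "'a::{field,finite}"
  assumes g: "primitive_elem g"
  shows "g ^ k = 1 \<longleftrightarrow> card (UNIV :: 'a set) - 1 dvd k"
proof
  let ?n = "card (UNIV :: 'a set) - 1"
  have "card {0, 1 :: 'a} \<le> card (UNIV :: 'a set)" by (intro card_mono) auto
  then have n: "?n > 0" by simp
  have g0: "g \<noteq> 0" using g by (simp add: primitive_elem_def)
  have gn: "g ^ ?n = 1" by (rule power_card_minus_1[OF g0])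
  assume k: "g ^ k = 1"
  define r where "r = k mod ?n"
  have "g ^ k = (g ^ ?n) ^ (k div ?n) * g ^ r"
    unfolding r_def by (simp flip: power_mult power_add)
  then have r: "g ^ r = 1" using k gn by simp
  have "r = 0"
  proof (rule ccontr)
    assume "r \<noteq> 0"
    have "UNIV - {0} \<subseteq> (\<lambda>i. g ^ i) ` {..<r}"
    proof
      fix x :: 'a assume "x \<in> UNIV - {0}"
      then obtain i where i: "x = g ^ i" using g unfolding primitive_elem_def by blast
      have "g ^ i = (g ^ r) ^ (i div r) * g ^ (i mod r)"
        by (simp flip: power_mult power_add)
      then have "x = g ^ (i mod r)" using r i by simp
      then show "x \<in> (\<lambda>i. g ^ i) ` {..<r}" using \<open>r \<noteq> 0\<close> by auto
    qed
    then have "card (UNIV - {0 :: 'a}) \<le> card {..<r}" by (rule surj_card_le[rotated]) simp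
    then have "?n \<le> r" by simp
    moreover have "r < ?n" unfolding r_def using n by simp
    ultimately show False by simp
  qed
  then show "?n dvd k" unfolding r_def by auto
next
  assume "card (UNIV :: 'a set) - 1 dvd k"
  then show "g ^ k = 1"
    using power_card_minus_1[of g] g by (auto simp: primitive_elem_def power_mult elim!: dvdE)
qed

lemma primepow_char:
  fixes q t :: nat
  assumes "primepow q" "card (UNIV :: 'a::{field,finite} set) = q ^ t"
  shows "prime CHAR('a)" "\<exists>n. q = CHAR('a) ^ n"
proof -
  obtain p k where p: "prime p" "k > 0" "q = p ^ k"
    using assms(1) unfolding primepow_def by auto
  show pr: "prime CHAR('a)"
    by (rule prime_CHAR_semidom) (rule finite_imp_CHAR_pos, simp)
  have "CHAR('a) dvd p ^ (k * t)"
    using CHAR_dvd_CARD[where 'a = 'a] assms(2) p(3) by (simp add: power_mult)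
  then have "CHAR('a) dvd p" using pr prime_dvd_power by blast
  then have "CHAR('a) = p" using pr p(1) primes_dvd_imp_eq by blast
  then show "\<exists>n. q = CHAR('a) ^ n" using p(3) by blast
qed

text \<open>Euclid's algorithm by subtraction: exponents of Frobenius powers fixing \<open>e\<close>
  are closed under differences, since a Frobenius power can be cancelled. This later turns a
  coincidence of conjugates into a divisor of \<open>t\<close>.\<close>

lemma power_eq_self_gcd:
  fixes e :: "'a::{field,finite}" and q t m n :: nat
  assumes card: "card (UNIV :: 'a set) = q ^ t"
    and inj: "\<And>x y :: 'a. x ^ q = y ^ q \<Longrightarrow> x = y"
    and "e ^ (q ^ m) = e" "e ^ (q ^ n) = e"
  shows "e ^ (q ^ gcd m n) = e"
proof -
  have injn: "x = y" if "x ^ (q ^ k) = y ^ (q ^ k)" for x y :: 'a and k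
    using that
  proof (induction k)
    case (Suc k)
    have "(x ^ (q ^ k)) ^ q = (y ^ (q ^ k)) ^ q"
      using Suc.prems by (simp add: mult.commute flip: power_mult)
    then show ?case by (rule Suc.IH[OF inj])
  qed simp
  have sub: "e ^ (q ^ (n - m)) = e" if "e ^ (q ^ m) = e" "e ^ (q ^ n) = e" "m \<le> n" for m n
  proof (rule injn)
    have "(e ^ (q ^ (n - m))) ^ (q ^ m) = e ^ (q ^ n)"
      using that(3) by (simp flip: power_mult power_add)
    then show "(e ^ (q ^ (n - m))) ^ (q ^ m) = e ^ (q ^ m)" using that by simp
  qed
  show ?thesis using assms(3,4)
  proof (induction "m + n" arbitrary: m n rule: less_induct)
    case less
    show ?case
    proof (cases "m = 0 \<or> n = 0")
      case False
      show ?thesis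
      proof (cases "m \<le> n")
        case True
        then have "e ^ (q ^ gcd m (n - m)) = e"
          using less(1)[of m "n - m"] less(2,3) sub[of m n] False by simp
        then show ?thesis using True by (metis gcd_diff1_nat gcd.commute)
      next
        case False': False
        then have "e ^ (q ^ gcd (m - n) n) = e"
          using less(1)[of "m - n" n] less(2,3) sub[of n m] False by simp
        then show ?thesis using False' by (simp add: gcd_diff1_nat)
      qed
    qed (use less in auto)
  qed
qed

section \<open>Norms and Hilbert 90\<close>

lemma power_geometric_sum_nat:
  fixes q :: nat
  assumes "q > 0"
  shows "(q - 1) * (\<Sum>i<n. q ^ i) = q ^ n - 1"
  using assms
proof (induction n)
  case (Suc n)
  have "(q - 1) * (\<Sum>i<Suc n. q ^ i) = q ^ n - 1 + (q - 1) * q ^ n"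
    using Suc by (simp add: distrib_left)
  also have "\<dots> = q ^ Suc n - 1"
    using Suc.prems by (simp add: diff_mult_distrib)
  finally show ?case .
qed simp

text \<open>Write \<open>x = g ^ k\<close> and let \<open>N\<close> be the norm exponent. Since
  \<open>(q - 1) * N = q ^ n - 1\<close> is the order of \<open>g\<close>, norm 1 means that
  \<open>(q - 1) * N\<close> divides \<open>k * N\<close>, so \<open>q - 1\<close> divides
  \<open>k\<close>.\<close>

lemma hilbert_90:
  fixes x :: "'a::{field,finite}"
  assumes card: "card (UNIV :: 'a set) = q ^ n" and q: "q > 1"
    and "x \<noteq> 0" "x ^ (\<Sum>i<n. q ^ i) = 1"
  shows "\<exists>y. y \<noteq> 0 \<and> y ^ (q - 1) = x"
proof -
  obtain g :: 'a where g: "primitive_elem g" using ex_primitive_elem by blast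
  then obtain k where k: "x = g ^ k" using assms(3) unfolding primitive_elem_def by blast
  have n0: "n \<noteq> 0"
  proof
    assume "n = 0"
    then have "card (UNIV :: 'a set) = 1" using card by simp
    then have "(0 :: 'a) = 1" by (metis UNIV_I card_1_singletonE singletonD)
    then show False by simp
  qed
  then have pos: "(\<Sum>i<n. q ^ i) > 0" using q by (intro sum_pos) auto
  have "g ^ (k * (\<Sum>i<n. q ^ i)) = 1" using assms(4) k by (simp add: power_mult)
  then have "q ^ n - 1 dvd k * (\<Sum>i<n. q ^ i)"
    using primitive_elem_power_eq_1_iff[OF g] card by metis
  then have "(q - 1) * (\<Sum>i<n. q ^ i) dvd k * (\<Sum>i<n. q ^ i)"
    using power_geometric_sum_nat[of q n] q by simp
  then have "q - 1 dvd k" using nat_mult_dvd_cancel1[OF pos] by (simp add: mult.commute)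
  then obtain j where "k = (q - 1) * j" by blast
  then have "(g ^ j) ^ (q - 1) = x" using k by (metis power_mult mult.commute)
  then show ?thesis using g by (intro exI[of _ "g ^ j"]) (auto simp: primitive_elem_def)
qed


section \<open>Embedding one finite field into another\<close>

text \<open>Integer polynomials are the common syntax: the same polynomial can be evaluated in two
  fields between which no map is known yet.\<close>

abbreviation int_eval :: "'a::field \<Rightarrow> int poly \<Rightarrow> 'a" where
  "int_eval x p \<equiv> poly (map_poly of_int p) x"

lemma int_eval_simps:
  fixes x :: "'a::field"
  shows "int_eval x (p + r) = int_eval x p + int_eval x r"
    "int_eval x (p - r) = int_eval x p - int_eval x r"
    "int_eval x (p * r) = int_eval x p * int_eval x r"
    "int_eval x 0 = 0" "int_eval x 1 = 1"
    "int_eval x (Polynomial.monom c n) = of_int c * x ^ n"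
    "int_eval x (Polynomial.smult c p) = of_int c * int_eval x p"
  by (simp_all add: of_int_poly_hom.hom_add of_int_poly_hom.hom_minus of_int_poly_hom.hom_mult
      of_int_hom.map_poly_hom_smult map_poly_monom poly_monom)

text \<open>In prime characteristic, a monic integer lift of the minimal polynomial of
  \<open>g\<close> over the prime field, determined only modulo the characteristic.\<close>

definition min_int_poly :: "'a::field \<Rightarrow> int poly \<Rightarrow> bool" where
  "min_int_poly g f \<longleftrightarrow> lead_coeff f = 1 \<and> int_eval g f = 0 \<and>
     (\<forall>h. lead_coeff h = 1 \<longrightarrow> int_eval g h = 0 \<longrightarrow> degree f \<le> degree h)"

lemma ex_min_int_poly:
  assumes "lead_coeff h = 1" "int_eval g h = 0"
  shows "\<exists>f. min_int_poly g f"
  using ex_has_least_nat[of "\<lambda>h. lead_coeff h = 1 \<and> int_eval g h = 0" h degree] assms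
  unfolding min_int_poly_def by blast

text \<open>A relation of degree below the minimal one has all coefficients divisible by the
  characteristic, since otherwise it could be made monic modulo the characteristic.\<close>

lemma int_eval_below_min:
  fixes g :: "'b::field" and x :: "'a::field"
  assumes f: "min_int_poly g f" and char: "CHAR('a) = CHAR('b)" "prime CHAR('b)"
    and "\<forall>k\<ge>n. Polynomial.coeff r k = 0" "n \<le> degree f" "int_eval g r = 0"
  shows "int_eval x r = 0"
  using assms(4-)
proof (induction n arbitrary: r)
  case 0
  then have "r = 0" by (intro poly_eqI) simp
  then show ?case by simp
next
  case (Suc n)
  define c where "c = Polynomial.coeff r n"
  show ?case
  proof (cases "int CHAR('b) dvd c")
    case True
    then have c: "(of_int c :: 'a) = 0" "(of_int c :: 'b) = 0"
      using char(1) by (simp_all add: of_int_eq_0_iff_char_dvd)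
    define r' where "r' = r - Polynomial.monom c n"
    have "Polynomial.coeff r' k = 0" if "k \<ge> n" for k
      using Suc.prems(1) that unfolding r'_def c_def by (cases "k = n") (auto simp: coeff_monom)
    moreover have "int_eval g r' = 0"
      using Suc.prems(3) c(2) unfolding r'_def by (simp add: int_eval_simps)
    ultimately have "int_eval x r' = 0" using Suc.IH[of r'] Suc.prems(2) by auto
    then show ?thesis using c(1) unfolding r'_def by (simp add: int_eval_simps)
  next
    case False
    then have "coprime (int CHAR('b)) c"
      using char(2) by (intro prime_imp_coprime) auto
    then obtain c' where c': "[c * c' = 1] (mod int CHAR('b))"
      using cong_solve_coprime_int[of c "int CHAR('b)"] by (auto simp: coprime_commute)
    define h where "h = Polynomial.smult c' r + Polynomial.monom (1 - c * c') n"
    have coeff_n: "Polynomial.coeff h n = 1"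
      unfolding h_def by (simp add: c_def coeff_monom mult.commute)
    have coeff_gt: "Polynomial.coeff h k = 0" if "k > n" for k
      using Suc.prems(1) that unfolding h_def by (auto simp: coeff_monom)
    have deg: "degree h = n"
      by (intro antisym degree_le le_degree) (use coeff_n coeff_gt in auto)
    have "int CHAR('b) dvd 1 - c * c'"
      using c' by (simp add: cong_iff_dvd_diff dvd_diff_commute)
    then have "(of_int (1 - c * c') :: 'b) = 0"
      by (simp only: of_int_eq_0_iff_char_dvd)
    then have "int_eval g h = 0"
      using Suc.prems(3) unfolding h_def int_eval_simps by simp
    then have "degree f \<le> degree h"
      using f deg coeff_n unfolding min_int_poly_def by auto
    then show ?thesis using deg Suc.prems(2) by simp
  qed
qed

text \<open>Pseudo-division by a monic polynomial is true division. The remainder vanishes at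
  \<open>g\<close> and has degree below the minimum, so it vanishes throughout the other field;
  relations at \<open>g\<close> thereby become transferable.\<close>

lemma min_int_poly_divmod:
  fixes g :: "'b::field"
  assumes f: "min_int_poly g f" and char: "CHAR('a::field) = CHAR('b)" "prime CHAR('b)"
    and r: "int_eval g r = 0"
  obtains h k where "r = f * h + k" "k = 0 \<or> degree k < degree f" "\<And>x :: 'a. int_eval x k = 0"
proof -
  obtain h k where hk: "pseudo_divmod r f = (h, k)" by force
  have lc: "lead_coeff f = 1" and f0: "int_eval g f = 0" using f by (auto simp: min_int_poly_def)
  then have "f \<noteq> 0" by auto
  from pseudo_divmod[OF this hk] lc have eq: "r = f * h + k" and deg: "k = 0 \<or> degree k < degree f" by auto
  have "int_eval g k = 0" using r f0 unfolding eq int_eval_simps by simp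
  moreover have "\<forall>i\<ge>degree f. Polynomial.coeff k i = 0" using deg by (auto intro: coeff_eq_0)
  ultimately have "int_eval x k = 0" for x :: 'a
    using int_eval_below_min[OF f char, of "degree f" k x] by simp
  then show ?thesis using that eq deg by blast
qed

text \<open>The upper bound counts roots of \<open>x ^ q - x\<close>. For the lower bound,
  \<open>N = (q ^ t - 1) / (q - 1)\<close> makes \<open>g ^ N\<close> an element of order
  \<open>q - 1\<close>; its powers and 0 are fixed.\<close>

lemma card_frob_fixed:
  assumes card: "card (UNIV :: 'a::{field,finite} set) = q ^ t" and q: "q > 1" and t: "t > 0"
  shows "card {x :: 'a. x ^ q = x} = q"
proof (rule antisym)
  let ?p = "Polynomial.monom 1 q - Polynomial.monom 1 1 :: 'a poly"
  have coeff: "Polynomial.coeff ?p q = 1" using q by (simp add: coeff_monom)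
  then have "?p \<noteq> 0" by (metis coeff_0 zero_neq_one)
  then have "card {x. poly ?p x = 0} \<le> degree ?p" by (rule card_poly_roots_bound)
  also have "degree ?p \<le> q" using q by (intro degree_le) (auto simp: coeff_monom)
  finally show "card {x :: 'a. x ^ q = x} \<le> q" by (simp add: poly_monom)
next
  obtain g :: 'a where g: "primitive_elem g" using ex_primitive_elem by blast
  define N where "N = (\<Sum>i<t. q ^ i)"
  have N: "(q - 1) * N = q ^ t - 1" unfolding N_def using power_geometric_sum_nat[of q t] q by simp
  have N0: "N > 0" unfolding N_def using q t by (intro sum_pos) auto
  have g0: "g \<noteq> 0" using g by (simp add: primitive_elem_def)
  have order: "g ^ k = 1 \<longleftrightarrow> (q - 1) * N dvd k" for k
    using primitive_elem_power_eq_1_iff[OF g] card N by simp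
  have le: "i = j" if "i \<le> j" "j < q - 1" "g ^ (N * i) = g ^ (N * j)" for i j
  proof -
    have "N * i + N * (j - i) = N * j" using that(1) by (simp flip: distrib_left)
    then have "g ^ (N * i) * g ^ (N * (j - i)) = g ^ (N * j)" by (simp flip: power_add)
    then have "g ^ (N * (j - i)) = 1" using that(3) g0 by simp
    then have "N * (q - 1) dvd N * (j - i)" unfolding order by (simp add: mult.commute)
    then have "q - 1 dvd j - i" using nat_mult_dvd_cancel1[OF N0] by blast
    then show ?thesis using that(1,2) by (auto dest: dvd_imp_le)
  qed
  have inj: "inj_on (\<lambda>i. g ^ (N * i)) {..<q - 1}"
  proof (rule inj_onI)
    fix i j assume "i \<in> {..<q - 1}" "j \<in> {..<q - 1}" "g ^ (N * i) = g ^ (N * j)"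
    then show "i = j" using le[of i j] le[of j i] by (cases "i \<le> j") auto
  qed
  have "(g ^ (N * i)) ^ q = g ^ (N * i)" for i
  proof -
    have "(g ^ (N * i)) ^ (q - 1) = (g ^ ((q - 1) * N)) ^ i"
      by (simp add: mult_ac flip: power_mult)
    also have "g ^ ((q - 1) * N) = 1" using order by simp
    finally have "g ^ (N * i) * (g ^ (N * i)) ^ (q - 1) = g ^ (N * i)" by simp
    then show ?thesis using q by (simp flip: power_Suc)
  qed
  then have "insert 0 ((\<lambda>i. g ^ (N * i)) ` {..<q - 1}) \<subseteq> {x. x ^ q = x}" using q by auto
  then have "card (insert 0 ((\<lambda>i. g ^ (N * i)) ` {..<q - 1})) \<le> card {x :: 'a. x ^ q = x}"
    by (intro card_mono) auto
  moreover have "0 \<notin> (\<lambda>i. g ^ (N * i)) ` {..<q - 1}" using g0 by auto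
  ultimately show "q \<le> card {x :: 'a. x ^ q = x}"
    using card_image[OF inj] by (simp add: card_insert_if)
qed

text \<open>A generator of the small field is sent to a root of its minimal polynomial in the big
  field; the image is then identified by counting.\<close>

lemma ex_field_embedding:
  fixes q t :: nat
  assumes q: "primepow q" and t: "t > 0"
    and card_a: "card (UNIV :: 'a::{field,finite} set) = q ^ t"
    and card_b: "card (UNIV :: 'b::{field,finite} set) = q"
  shows "\<exists>\<phi> :: 'b \<Rightarrow> 'a. (\<forall>x y. \<phi> (x + y) = \<phi> x + \<phi> y) \<and> (\<forall>x y. \<phi> (x * y) = \<phi> x * \<phi> y) \<and>
    inj \<phi> \<and> range \<phi> = {x. x ^ q = x}"
proof -
  have q1: "q > 1" using q primepow_gt_Suc_0 by auto
  have card_b': "card (UNIV :: 'b set) = q ^ 1" using card_b by simp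
  obtain n n' where n: "q = CHAR('a) ^ n" "q = CHAR('b) ^ n'"
    using primepow_char(2)[OF q card_a] primepow_char(2)[OF q card_b'] by blast
  note primes = primepow_char(1)[OF q card_a] primepow_char(1)[OF q card_b']
  have "n \<noteq> 0" using n(1) q1 by (cases n) auto
  then have "CHAR('a) dvd CHAR('b) ^ n'" using n by (metis dvd_power neq0_conv)
  then have char: "CHAR('a) = CHAR('b)"
    using primes by (meson prime_dvd_power primes_dvd_imp_eq)
  obtain g :: 'b where g: "primitive_elem g" using ex_primitive_elem by blast
  have gq: "g ^ q = g" using power_card_eq[of g] card_b by simp
  define m :: "int poly" where "m = Polynomial.monom 1 q - Polynomial.monom 1 1"
  have m_deg: "degree m = q"
    unfolding m_def using q1 by (intro antisym degree_le le_degree) (auto simp: coeff_monom)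
  have m_lc: "lead_coeff m = 1" unfolding m_deg unfolding m_def using q1 by (simp add: coeff_monom)
  have m_eval: "int_eval x m = x ^ q - x" for x :: "'c::field"
    unfolding m_def int_eval_simps by simp
  have m_g: "int_eval g m = 0" using gq by (simp add: m_eval)
  obtain f where f: "min_int_poly g f" using ex_min_int_poly[OF m_lc m_g] by blast
  then have f_lc: "lead_coeff f = 1" and f_g: "int_eval g f = 0"
    and f_deg: "degree f \<le> q"
    using m_lc m_g m_deg unfolding min_int_poly_def by auto
  have f_deg0: "degree f > 0"
  proof (rule ccontr)
    assume "\<not> degree f > 0"
    then have "f = 1" using f_lc by (auto elim!: degree_eq_zeroE)
    then show False using f_g by simp
  qed
  \<comment> \<open>Modulo the characteristic \<open>f\<close> divides \<open>x ^ q - x\<close>. The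
    cofactor \<open>h\<close> has degree less than \<open>q\<close>, so it cannot vanish at all
    \<open>q\<close> solutions of \<open>x ^ q = x\<close>, and \<open>f\<close> vanishes at one of
    them.\<close>
  obtain x0 :: 'a where x0: "int_eval x0 f = 0" "x0 ^ q = x0"
  proof -
    obtain h k where hk: "m = f * h + k" "k = 0 \<or> degree k < degree f" "\<And>x :: 'a. int_eval x k = 0"
      using min_int_poly_divmod[OF f char primes(2) m_g] by blast
    have fh: "f * h = m - k" using hk(1) by simp
    have k_coeff: "Polynomial.coeff k i = 0" if "i \<ge> q" for i
      using hk(2) f_deg that by (auto intro: coeff_eq_0)
    have fh_q: "Polynomial.coeff (f * h) q = 1"
      unfolding fh using m_lc m_deg k_coeff[of q] by simp
    have fh_deg: "degree (f * h) = q"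
    proof (rule antisym)
      show "degree (f * h) \<le> q"
        unfolding fh using k_coeff m_deg by (intro degree_le) (auto simp: coeff_eq_0)
      show "q \<le> degree (f * h)" using fh_q by (intro le_degree) simp
    qed
    have "f * h \<noteq> 0" using fh_q by (metis coeff_0 zero_neq_one)
    then have deg: "degree f + degree h = q" using fh_deg by (simp add: degree_mult_eq)
    have h_lc: "lead_coeff h = 1"
      using fh_q fh_deg f_lc lead_coeff_mult[of f h] by simp
    let ?h = "map_poly of_int h :: 'a poly"
    have "Polynomial.coeff ?h (degree h) = 1" using h_lc by (simp add: coeff_map_poly)
    then have "?h \<noteq> 0" by (metis coeff_0 zero_neq_one)
    then have "card {x. poly ?h x = 0} \<le> degree ?h" by (rule card_poly_roots_bound)
    also have "\<dots> \<le> degree h" by (rule degree_map_poly_le)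
    also have "\<dots> < card {x :: 'a. x ^ q = x}"
      using deg f_deg0 card_frob_fixed[OF card_a q1 t] by simp
    finally have "\<not> {x :: 'a. x ^ q = x} \<subseteq> {x. poly ?h x = 0}"
      by (metis card_mono finite leD)
    then obtain x :: 'a where x: "x ^ q = x" "poly ?h x \<noteq> 0" by blast
    have "int_eval x m = int_eval x f * int_eval x h"
      unfolding hk(1) int_eval_simps using hk(3) by simp
    then show ?thesis using that[of x] x m_eval[of x] by simp
  qed
  have transfer: "int_eval x0 p = int_eval x0 r" if "int_eval g p = int_eval g r" for p r
  proof -
    have "int_eval g (p - r) = 0" using that by (simp add: int_eval_simps)
    from min_int_poly_divmod[OF f char primes(2) this]
    obtain h k where hk: "p - r = f * h + k" "\<And>x :: 'a. int_eval x k = 0" by metis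
    have "int_eval x0 (p - r) = 0" unfolding hk(1) int_eval_simps using hk(2) x0(1) by simp
    then show ?thesis by (simp add: int_eval_simps)
  qed
  have surj: "\<exists>p. int_eval g p = y" for y
  proof (cases "y = 0")
    case True
    then show ?thesis by (intro exI[of _ 0]) simp
  next
    case False
    then obtain k where "y = g ^ k" using g unfolding primitive_elem_def by blast
    then show ?thesis by (intro exI[of _ "Polynomial.monom 1 k"]) (simp add: poly_monom)
  qed
  \<comment> \<open>By \<open>transfer\<close>, the value at \<open>x0\<close> does not depend on
    the polynomial chosen to represent \<open>y\<close>.\<close>
  define \<phi> where "\<phi> y = int_eval x0 (SOME p. int_eval g p = y)" for y
  have phi: "\<phi> (int_eval g p) = int_eval x0 p" for p
    unfolding \<phi>_def by (rule transfer) (rule someI[of _ p], simp)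
  have add: "\<phi> (x + y) = \<phi> x + \<phi> y" and mult: "\<phi> (x * y) = \<phi> x * \<phi> y" for x y
  proof -
    obtain p r where "x = int_eval g p" "y = int_eval g r" using surj by metis
    then show "\<phi> (x + y) = \<phi> x + \<phi> y" "\<phi> (x * y) = \<phi> x * \<phi> y"
      by (simp_all add: phi flip: int_eval_simps)
  qed
  have one: "\<phi> 1 = 1" using phi[of 1] by (simp add: int_eval_simps)
  have zero: "\<phi> 0 = 0" using phi[of 0] by (simp add: int_eval_simps)
  have inj: "inj \<phi>"
  proof (rule injI)
    fix x y assume eq: "\<phi> x = \<phi> y"
    show "x = y"
    proof (rule ccontr)
      assume "x \<noteq> y"
      then have "\<phi> ((x - y) * (1 / (x - y))) = 1" using one by simp
      moreover have "\<phi> (x - y) = 0" using add[of "x - y" y] eq by simp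
      ultimately show False unfolding mult by simp
    qed
  qed
  have pow: "\<phi> (x ^ k) = \<phi> x ^ k" for x k by (induction k) (simp_all add: one mult)
  have "range \<phi> \<subseteq> {x. x ^ q = x}"
    using power_card_eq[where 'a = 'b] card_b by (auto simp flip: pow)
  moreover have "card (range \<phi>) = card {x :: 'a. x ^ q = x}"
    using card_image[OF inj] card_b card_frob_fixed[OF card_a q1 t] by simp
  ultimately have "range \<phi> = {x. x ^ q = x}" by (intro card_subset_eq) auto
  then show ?thesis using add mult inj by blast
qed


section \<open>Binary forms and normal rational curves\<close>

text \<open>Homogeneous polynomial functions, encoded as in Horner's scheme by splitting off the
  pure power of \<open>v\<close>: closure properties and division become inductions on
  \<open>d\<close> without manipulating coefficient sums.\<close>

primrec binary_form :: "nat \<Rightarrow> ('a::field \<Rightarrow> 'a \<Rightarrow> 'a) \<Rightarrow> bool" where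
  "binary_form 0 F \<longleftrightarrow> (\<exists>c. \<forall>u v. F u v = c)"
| "binary_form (Suc d) F \<longleftrightarrow> (\<exists>G c. binary_form d G \<and> (\<forall>u v. F u v = u * G u v + c * v ^ Suc d))"

lemma binary_form_sum: "binary_form d (\<lambda>u v. \<Sum>i\<le>d. c i * (u ^ (d - i) * v ^ i))"
proof (induction d)
  case (Suc d)
  have "(\<Sum>i\<le>Suc d. c i * (u ^ (Suc d - i) * v ^ i))
      = u * (\<Sum>i\<le>d. c i * (u ^ (d - i) * v ^ i)) + c (Suc d) * v ^ Suc d" for u v
    by (simp add: sum_distrib_left Suc_diff_le mult_ac)
  then show ?case using Suc unfolding binary_form.simps by blast
qed simp

lemma binary_form_coeffs:
  assumes "binary_form d F"
  shows "\<exists>c. \<forall>u v. F u v = (\<Sum>i\<le>d. c i * (u ^ (d - i) * v ^ i))"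
  using assms
proof (induction d arbitrary: F)
  case (Suc d)
  then obtain G k where G: "binary_form d G" "\<And>u v. F u v = u * G u v + k * v ^ Suc d"
    by auto
  from Suc.IH[OF G(1)] obtain c where c: "\<And>u v. G u v = (\<Sum>i\<le>d. c i * (u ^ (d - i) * v ^ i))"
    by auto
  have "F u v = (\<Sum>i\<le>Suc d. (c(Suc d := k)) i * (u ^ (Suc d - i) * v ^ i))" for u v
    unfolding G(2) c by (simp add: sum_distrib_left Suc_diff_le mult_ac)
  then show ?case by blast
qed auto

lemma binary_form_add:
  assumes "binary_form d F" "binary_form d G"
  shows "binary_form d (\<lambda>u v. F u v + G u v)"
  using assms
proof (induction d arbitrary: F G)
  case (Suc d)
  obtain F' a where F: "binary_form d F'" "\<And>u v. F u v = u * F' u v + a * v ^ Suc d"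
    using Suc.prems(1) by auto
  obtain G' b where G: "binary_form d G'" "\<And>u v. G u v = u * G' u v + b * v ^ Suc d"
    using Suc.prems(2) by auto
  have "F u v + G u v = u * (F' u v + G' u v) + (a + b) * v ^ Suc d" for u v
    unfolding F(2) G(2) by (simp add: algebra_simps)
  then show ?case using Suc.IH[OF F(1) G(1)] unfolding binary_form.simps by blast
qed auto

lemma binary_form_smult:
  assumes "binary_form d F"
  shows "binary_form d (\<lambda>u v. k * F u v)"
  using assms
proof (induction d arbitrary: F)
  case (Suc d)
  obtain G a where G: "binary_form d G" "\<And>u v. F u v = u * G u v + a * v ^ Suc d"
    using Suc.prems by auto
  have "k * F u v = u * (k * G u v) + (k * a) * v ^ Suc d" for u v
    unfolding G(2) by (simp add: algebra_simps)
  then show ?case using Suc.IH[OF G(1)] unfolding binary_form.simps by blast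
qed auto

lemma binary_form_mult_right:
  assumes "binary_form d F"
  shows "binary_form (Suc d) (\<lambda>u v. v * F u v)"
  using assms
proof (induction d arbitrary: F)
  case 0
  then obtain c where "\<And>u v. F u v = c" by auto
  then have "v * F u v = u * 0 + c * v ^ Suc 0" for u v by simp
  moreover have "binary_form 0 (\<lambda>u v. 0 :: 'a)" by simp
  ultimately show ?case unfolding binary_form.simps(2) by blast
next
  case (Suc d)
  obtain G a where G: "binary_form d G" "\<And>u v. F u v = u * G u v + a * v ^ Suc d"
    using Suc.prems by auto
  have "v * F u v = u * (v * G u v) + a * v ^ Suc (Suc d)" for u v
    unfolding G(2) by (simp add: algebra_simps)
  then show ?case using Suc.IH[OF G(1)] unfolding binary_form.simps(2)[of "Suc d"] by blast
qed

lemma binary_form_mult_left: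
  assumes "binary_form d F"
  shows "binary_form (Suc d) (\<lambda>u v. u * F u v)"
proof -
  have "u * F u v = u * F u v + 0 * v ^ Suc d" for u v by simp
  then show ?thesis using assms unfolding binary_form.simps by blast
qed

lemma binary_form_mult_linear:
  assumes "binary_form d F"
  shows "binary_form (Suc d) (\<lambda>u v. (a * u + b * v) * F u v)"
proof -
  have "binary_form (Suc d) (\<lambda>u v. a * (u * F u v) + b * (v * F u v))"
    by (intro binary_form_add binary_form_smult binary_form_mult_left binary_form_mult_right assms)
  then show ?thesis by (simp add: algebra_simps)
qed

lemma binary_form_prod_linear:
  assumes "finite I"
  shows "binary_form (card I) (\<lambda>u v. \<Prod>i\<in>I. a i * u + b i * v)"
  using assms
proof (induction I rule: finite_induct)
  case (insert i I)
  then show ?case using binary_form_mult_linear[OF insert.IH] by simp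
qed simp

section \<open>Zeros and linear factors of binary forms\<close>

lemma binary_form_scale:
  assumes "binary_form d F"
  shows "F (k * u) (k * v) = k ^ d * F u v"
  using assms
proof (induction d arbitrary: F)
  case (Suc d)
  obtain G a where G: "binary_form d G" "\<And>u v. F u v = u * G u v + a * v ^ Suc d"
    using Suc.prems by auto
  show ?case unfolding G(2) Suc.IH[OF G(1)] by (simp add: algebra_simps power_mult_distrib)
qed auto

text \<open>Horner's scheme: the new quotient is \<open>u\<close> times the inner quotient plus the
  inner remainder.\<close>

lemma binary_form_synthetic_division:
  assumes "binary_form (Suc d) F"
  shows "\<exists>G. binary_form d G \<and> (\<forall>u v. F u v = (u - a * v) * G u v + F a 1 * v ^ Suc d)"
  using assms
proof (induction d arbitrary: F)
  case 0
  then obtain c b where "\<And>u v. F u v = u * c + b * v" by fastforce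
  then show ?case by (intro exI[of _ "\<lambda>u v. c"]) (auto simp: algebra_simps)
next
  case (Suc d)
  then obtain G c where G: "binary_form (Suc d) G" "\<And>u v. F u v = u * G u v + c * v ^ Suc (Suc d)"
    unfolding binary_form.simps(2)[of "Suc d"] by blast
  obtain H where H: "binary_form d H" "\<And>u v. G u v = (u - a * v) * H u v + G a 1 * v ^ Suc d"
    using Suc.IH[OF G(1)] by blast
  let ?K = "\<lambda>u v. u * H u v + G a 1 * v ^ Suc d"
  have "F u v = (u - a * v) * ?K u v + F a 1 * v ^ Suc (Suc d)" for u v
    unfolding G(2)[of u v] G(2)[of a 1] H(2)[of u v] by (simp add: algebra_simps)
  moreover have "binary_form (Suc d) ?K" using H(1) by auto
  ultimately show ?case by blast
qed

text \<open>The zero at infinity, which division by \<open>u - a * v\<close> does not reach.\<close>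

lemma binary_form_divide_right:
  assumes "binary_form (Suc d) F" "F 1 0 = 0"
  shows "\<exists>G. binary_form d G \<and> (\<forall>u v. F u v = v * G u v)"
  using assms
proof (induction d arbitrary: F)
  case 0
  then obtain c b where "\<And>u v. F u v = u * c + b * v" by fastforce
  with 0(2) show ?case by (intro exI[of _ "\<lambda>u v. b"]) auto
next
  case (Suc d)
  then obtain G c where G: "binary_form (Suc d) G" "\<And>u v. F u v = u * G u v + c * v ^ Suc (Suc d)"
    unfolding binary_form.simps(2)[of "Suc d"] by blast
  have "G 1 0 = 0" using Suc.prems(2) G(2)[of 1 0] by simp
  from Suc.IH[OF G(1) this] obtain H where H: "binary_form d H" "\<And>u v. G u v = v * H u v" by blast
  have "F u v = v * (u * H u v + c * v ^ Suc d)" for u v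
    unfolding G(2) H(2) by (simp add: algebra_simps)
  moreover have "binary_form (Suc d) (\<lambda>u v. u * H u v + c * v ^ Suc d)" using H(1) by auto
  ultimately show ?case by blast
qed

text \<open>Zeros are projective: after scaling, a zero is \<open>(1, 0)\<close> or
  \<open>(a / b, 1)\<close>, and the scalar is absorbed by the quotient.\<close>

lemma binary_form_factor:
  assumes F: "binary_form (Suc d) F" "F a b = 0" and ab: "(a, b) \<noteq> (0, 0)"
  shows "\<exists>G. binary_form d G \<and> (\<forall>u v. F u v = (b * u - a * v) * G u v)"
proof (cases "b = 0")
  case True
  then have a: "a \<noteq> 0" using ab by simp
  have "F 1 0 = 0" using binary_form_scale[OF F(1), of a 1 0] F(2) True a by simp
  from binary_form_divide_right[OF F(1) this]
  obtain G where G: "binary_form d G" "\<And>u v. F u v = v * G u v" by blast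
  have "F u v = (b * u - a * v) * ((- 1 / a) * G u v)" for u v
    unfolding G(2) using a True by simp
  moreover have "binary_form d (\<lambda>u v. (- 1 / a) * G u v)" by (rule binary_form_smult[OF G(1)])
  ultimately show ?thesis by blast
next
  case False
  have "F (b * (a / b)) (b * 1) = b ^ Suc d * F (a / b) 1" by (rule binary_form_scale[OF F(1)])
  then have "F (a / b) 1 = 0" using False F(2) by simp
  with binary_form_synthetic_division[OF F(1), of "a / b"]
  obtain G where G: "binary_form d G" "\<And>u v. F u v = (u - a / b * v) * G u v" by auto
  have "F u v = (b * u - a * v) * ((1 / b) * G u v)" for u v
    unfolding G(2) using False by (simp add: field_simps)
  moreover have "binary_form d (\<lambda>u v. (1 / b) * G u v)" by (rule binary_form_smult[OF G(1)])
  ultimately show ?thesis by blast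
qed

text \<open>Independent zeros can be split off one by one, since the factor of one zero does not
  vanish at another; when their number equals the degree, only a constant is left. This recovers the
  coordinates of a curve from its indicator points.\<close>

lemma binary_form_zeros:
  assumes "finite I" "binary_form (card I) F"
    and "\<And>i. i \<in> I \<Longrightarrow> F (a i) (b i) = 0" "\<And>i. i \<in> I \<Longrightarrow> (a i, b i) \<noteq> (0, 0)"
    and "\<And>i j. i \<in> I \<Longrightarrow> j \<in> I \<Longrightarrow> i \<noteq> j \<Longrightarrow> b i * a j \<noteq> a i * b j"
  shows "\<exists>k. \<forall>u v. F u v = k * (\<Prod>i\<in>I. b i * u - a i * v)"
  using assms
proof (induction I arbitrary: F rule: finite_induct)
  case (insert x I)
  have "binary_form (Suc (card I)) F" using insert by simp
  from binary_form_factor[OF this, of "a x" "b x"] insert.prems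
  obtain G where G: "binary_form (card I) G" "\<And>u v. F u v = (b x * u - a x * v) * G u v" by auto
  have "G (a i) (b i) = 0" if "i \<in> I" for i
  proof -
    have "x \<noteq> i" using insert.hyps(2) that by auto
    then have "b x * a i - a x * b i \<noteq> 0" using insert.prems(4)[of x i] that by auto
    then show ?thesis using insert.prems(2)[of i] that unfolding G(2) by auto
  qed
  from insert.IH[OF G(1) this] insert.prems
  obtain k where "\<And>u v. G u v = k * (\<Prod>i\<in>I. b i * u - a i * v)" by auto
  then have "F u v = k * (\<Prod>i\<in>insert x I. b i * u - a i * v)" for u v
    unfolding G(2) using insert.hyps by (simp add: mult_ac)
  then show ?case by blast
qed simp

section \<open>Curves described by coordinate forms\<close>

lemma mult_mat_veronese:
  assumes "m < n"
  shows "(mat n (Suc d) (\<lambda>(m, i). c m i) *\<^sub>v vec (Suc d) (\<lambda>i. u ^ (d - i) * v ^ i)) $ m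
    = (\<Sum>i\<le>d. c m i * (u ^ (d - i) * v ^ i))"
  using assms by (simp add: scalar_prod_def atLeast0LessThan lessThan_Suc_atMost del: sum.lessThan_Suc)

lemma normal_rational_curve_forms:
  assumes "normal_rational_curve n d C"
  shows "\<exists>F. (\<forall>m<n. binary_form d (F m)) \<and>
    C = {pg_point n (vec n (\<lambda>m. F m u v)) | u v. (u, v) \<noteq> (0, 0)}"
proof -
  obtain A where A: "A \<in> carrier_mat n (d + 1)"
    "C = {pg_point n (A *\<^sub>v vec (d + 1) (\<lambda>i. u ^ (d - i) * v ^ i)) | u v. (u, v) \<noteq> (0, 0)}"
    using assms unfolding normal_rational_curve_def by blast
  let ?F = "\<lambda>m u v. \<Sum>i\<le>d. A $$ (m, i) * (u ^ (d - i) * v ^ i)"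
  have "A = mat n (Suc d) (\<lambda>(m, i). A $$ (m, i))" using A(1) by (intro eq_matI) auto
  then have "A *\<^sub>v vec (d + 1) (\<lambda>i. u ^ (d - i) * v ^ i) = vec n (\<lambda>m. ?F m u v)" for u v
    using mult_mat_veronese[of _ n d "\<lambda>m i. A $$ (m, i)" u v] A(1) by (intro eq_vecI) auto
  then have C: "C = {pg_point n (vec n (\<lambda>m. ?F m u v)) | u v. (u, v) \<noteq> (0, 0)}"
    unfolding A(2) by simp
  show ?thesis
    by (rule exI[of _ ?F], rule conjI[OF _ C]) (intro allI impI binary_form_sum)
qed

lemma carrier_vec_bij_lists:
  "bij_betw vec_of_list {xs :: 'a list. set xs \<subseteq> UNIV \<and> length xs = n} (carrier_vec n)"
  by (rule bij_betwI[of _ _ _ list_of_vec]) (auto simp: vec_list list_vec intro!: carrier_vecI)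

lemma finite_carrier_vec: "finite (carrier_vec n :: 'a::finite vec set)"
  using bij_betw_finite[OF carrier_vec_bij_lists[where 'a = 'a, of n]]
    finite_lists_length_eq[of "UNIV :: 'a set" n] by simp

lemma card_carrier_vec: "card (carrier_vec n :: 'a::finite vec set) = card (UNIV :: 'a set) ^ n"
  using bij_betw_same_card[OF carrier_vec_bij_lists[where 'a = 'a, of n]]
    card_lists_length_eq[of "UNIV :: 'a set" n] by simp

text \<open>By \<open>pts\<close>, the first \<open>d + 1\<close> coordinates take multiples of all
  unit vectors as values on the curve. So the matrix \<open>?B\<close> of the first
  \<open>d + 1\<close> rows is onto, hence injective by finiteness, and the further rows of
  \<open>?A\<close> keep it injective.\<close>

lemma normal_rational_curveI:
  fixes F :: "nat \<Rightarrow> 'a::{field,finite} \<Rightarrow> 'a \<Rightarrow> 'a"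
  assumes F: "\<And>m. m < n \<Longrightarrow> binary_form d (F m)" and "d < n"
    and pts: "\<And>j. j \<le> d \<Longrightarrow> \<exists>u v. F j u v \<noteq> 0 \<and> (\<forall>i\<le>d. i \<noteq> j \<longrightarrow> F i u v = 0)"
  shows "normal_rational_curve n d {pg_point n (vec n (\<lambda>m. F m u v)) | u v. (u, v) \<noteq> (0, 0)}"
proof -
  have "\<forall>m. \<exists>c. m < n \<longrightarrow> (\<forall>u v. F m u v = (\<Sum>i\<le>d. c i * (u ^ (d - i) * v ^ i)))"
    using binary_form_coeffs[OF F] by blast
  then obtain c where c: "\<And>m u v. m < n \<Longrightarrow> F m u v = (\<Sum>i\<le>d. c m i * (u ^ (d - i) * v ^ i))"
    by metis
  let ?A = "mat n (Suc d) (\<lambda>(m, i). c m i)" and ?B = "mat (Suc d) (Suc d) (\<lambda>(m, i). c m i)"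
  let ?V = "\<lambda>u v. vec (Suc d) (\<lambda>i. u ^ (d - i) * v ^ i)" and ?K = "carrier_vec (Suc d) :: 'a vec set"
  have A: "?A *\<^sub>v ?V u v = vec n (\<lambda>m. F m u v)" for u v
    using mult_mat_veronese[of _ n d c u v] c by (intro eq_vecI) auto
  have B: "?B *\<^sub>v ?V u v = vec (Suc d) (\<lambda>m. F m u v)" for u v
    using mult_mat_veronese[of _ "Suc d" d c u v] c \<open>d < n\<close> by (intro eq_vecI) auto
  obtain a b where ab: "\<And>j. j \<le> d \<Longrightarrow> F j (a j) (b j) \<noteq> 0"
    "\<And>i j. j \<le> d \<Longrightarrow> i \<le> d \<Longrightarrow> i \<noteq> j \<Longrightarrow> F i (a j) (b j) = 0"
    using pts by metis
  have range: "closed_subspace (Suc d) ((*\<^sub>v) ?B ` ?K)"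
    unfolding closed_subspace_def
  proof (intro conjI ballI allI)
    have "?B *\<^sub>v 0\<^sub>v (Suc d) = 0\<^sub>v (Suc d)" by (intro eq_vecI) auto
    then show "0\<^sub>v (Suc d) \<in> (*\<^sub>v) ?B ` ?K" by (metis image_eqI zero_carrier_vec)
  next
    fix x y assume "x \<in> (*\<^sub>v) ?B ` ?K" "y \<in> (*\<^sub>v) ?B ` ?K"
    then obtain x' y' where "x' \<in> ?K" "y' \<in> ?K" "x = ?B *\<^sub>v x'" "y = ?B *\<^sub>v y'" by blast
    then show "x + y \<in> (*\<^sub>v) ?B ` ?K"
      by (intro image_eqI[of _ _ "x' + y'"]) (auto intro!: mult_add_distrib_mat_vec[symmetric])
  next
    fix x k assume "x \<in> (*\<^sub>v) ?B ` ?K"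
    then obtain x' where "x' \<in> ?K" "x = ?B *\<^sub>v x'" by blast
    then show "k \<cdot>\<^sub>v x \<in> (*\<^sub>v) ?B ` ?K"
      by (intro image_eqI[of _ _ "k \<cdot>\<^sub>v x'"]) (auto intro!: mult_mat_vec[symmetric])
  qed (auto intro: carrier_vecI)
  have "?K \<subseteq> (*\<^sub>v) ?B ` ?K"
  proof
    fix y assume y: "y \<in> ?K"
    \<comment> \<open>Expansion of \<open>y\<close> in unit vectors, each obtained from the Veronese
      vector at \<open>(a j, b j)\<close> by dividing out its one nonzero coordinate.\<close>
    have "vec (Suc d) (\<lambda>m. \<Sum>j\<in>{..d}. (y $ j / F j (a j) (b j)) * F m (a j) (b j)) \<in> (*\<^sub>v) ?B ` ?K"
    proof (rule closed_subspace_sum[OF range])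
      fix k
      show "vec (Suc d) (\<lambda>m. F m (a k) (b k)) \<in> (*\<^sub>v) ?B ` ?K"
        by (rule image_eqI[of _ _ "?V (a k) (b k)"]) (simp_all add: B)
    qed simp
    also have "vec (Suc d) (\<lambda>m. \<Sum>j\<in>{..d}. (y $ j / F j (a j) (b j)) * F m (a j) (b j)) = y"
    proof (rule eq_vecI)
      fix m assume "m < dim_vec y"
      then have m: "m \<le> d" using y by simp
      have "(\<Sum>j\<in>{..d}. (y $ j / F j (a j) (b j)) * F m (a j) (b j))
          = (\<Sum>j\<in>{..d}. if j = m then y $ m else 0)"
        using ab m by (intro sum.cong) auto
      then show "vec (Suc d) (\<lambda>m. \<Sum>j\<in>{..d}. (y $ j / F j (a j) (b j)) * F m (a j) (b j)) $ m = y $ m"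
        using m by simp
    qed (use y in simp)
    finally show "y \<in> (*\<^sub>v) ?B ` ?K" .
  qed
  then have "card ?K \<le> card ((*\<^sub>v) ?B ` ?K)"
    by (intro card_mono finite_imageI finite_carrier_vec)
  then have "card ((*\<^sub>v) ?B ` ?K) = card ?K"
    using card_image_le[OF finite_carrier_vec] by (intro antisym)
  then have injB: "inj_on ((*\<^sub>v) ?B) ?K" by (rule eq_card_imp_inj_on[OF finite_carrier_vec])
  have "inj_on ((*\<^sub>v) ?A) ?K"
  proof (rule inj_onI)
    fix x y assume xy: "x \<in> ?K" "y \<in> ?K" "?A *\<^sub>v x = ?A *\<^sub>v y"
    have "?B *\<^sub>v x = ?B *\<^sub>v y"
    proof (rule eq_vecI)
      fix m assume "m < dim_vec (?B *\<^sub>v y)"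
      then have m: "m < Suc d" by simp
      have "(?B *\<^sub>v z) $ m = (?A *\<^sub>v z) $ m" if "z \<in> ?K" for z
        using m \<open>d < n\<close> that by (simp add: scalar_prod_def)
      then show "(?B *\<^sub>v x) $ m = (?B *\<^sub>v y) $ m" using xy by simp
    qed simp
    then show "x = y" using inj_onD[OF injB] xy by blast
  qed
  then show ?thesis
    unfolding normal_rational_curve_def
    by (intro bexI[of _ ?A] conjI) (auto simp flip: A)
qed


section \<open>The subgeometry\<close>

locale big_field =
  fixes q t :: nat and ty :: "'a::{field,finite} itself"
  assumes primepow_q: "primepow q" and t_gt: "t > 3"
    and card_a: "card (UNIV :: 'a set) = q ^ t"
begin

lemma q_gt_1: "q > 1"
  using primepow_q primepow_gt_Suc_0 by auto

lemma power_add_q: "((x :: 'a) + y) ^ (q ^ m) = x ^ (q ^ m) + y ^ (q ^ m)"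
proof -
  obtain n where n: "q = CHAR('a) ^ n" using primepow_char(2)[OF primepow_q card_a] by blast
  show ?thesis
    by (rule freshmans_dream'[OF primepow_char(1)[OF primepow_q card_a], of _ "n * m"])
       (simp add: n power_mult)
qed

lemma power_qt [simp]: "(x :: 'a) ^ (q ^ t) = x"
  using power_card_eq[of x] card_a by simp

lemma power_q_inj: "(x :: 'a) ^ q = y ^ q \<Longrightarrow> x = y"
proof -
  assume "x ^ q = y ^ q"
  then have "(x ^ q) ^ (q ^ (t - 1)) = (y ^ q) ^ (q ^ (t - 1))" by simp
  moreover have "q * q ^ (t - 1) = q ^ t" using t_gt by (cases t) auto
  ultimately show "x = y" by (metis power_mult power_qt)
qed

lemma power_qm_inj: "(x :: 'a) ^ (q ^ m) = y ^ (q ^ m) \<Longrightarrow> x = y"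
proof (induction m)
  case (Suc m)
  have "(x ^ (q ^ m)) ^ q = (y ^ (q ^ m)) ^ q"
    using Suc.prems by (simp add: mult.commute flip: power_mult)
  then show ?case by (rule Suc.IH[OF power_q_inj])
qed simp

lemma power_q_surj: "\<exists>y :: 'a. y ^ q = x"
proof -
  have "surj (\<lambda>y :: 'a. y ^ q)"
    by (rule finite_UNIV_inj_surj) (auto intro!: injI power_q_inj)
  then show ?thesis by (metis surjD)
qed

lemma power_diff_q: "((x :: 'a) - y) ^ (q ^ m) = x ^ (q ^ m) - y ^ (q ^ m)"
  using power_add_q[of "x - y" y m] by simp

lemma power_q_Suc: "(x :: 'a) ^ (q ^ Suc m) = (x ^ (q ^ m)) ^ q"
  by (simp add: mult.commute flip: power_mult)

lemma power_q_fixed: "(x :: 'a) ^ (q ^ s) = x \<Longrightarrow> x ^ (q ^ (s * k)) = x"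
proof (induction k)
  case (Suc k)
  have "x ^ (q ^ (s * Suc k)) = (x ^ (q ^ s)) ^ (q ^ (s * k))"
    by (simp flip: power_mult power_add)
  then show ?case using Suc by simp
qed simp

lemma power_q_mod:
  assumes "(x :: 'a) ^ (q ^ s) = x"
  shows "x ^ (q ^ (m mod s)) = x ^ (q ^ m)"
proof -
  have "x ^ (q ^ m) = (x ^ (q ^ (s * (m div s)))) ^ (q ^ (m mod s))"
    by (simp flip: power_mult power_add)
  then show ?thesis using power_q_fixed[OF assms] by simp
qed

section \<open>Vectors of conjugates and the semilinear shift\<close>

definition conj_vec :: "'a \<Rightarrow> 'a vec" where
  "conj_vec a = vec t (\<lambda>m. a ^ (q ^ m))"

text \<open>The part of \<open>conj_vec a\<close> on the coordinates congruent to \<open>j\<close>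
  modulo \<open>s\<close>. For \<open>j < s\<close> these parts represent the indicator points of
  the spread element through the point of \<open>conj_vec a\<close>.\<close>

definition ind_vec :: "'a \<Rightarrow> nat \<Rightarrow> nat \<Rightarrow> 'a vec" where
  "ind_vec a s j = vec t (\<lambda>m. if m mod s = j then a ^ (q ^ m) else 0)"

text \<open>With the reciprocal built in, lines of the target correspond to additive combinations of
  arguments.\<close>

definition pt :: "'a \<Rightarrow> 'a vec set" where
  "pt w = pg_point t (conj_vec (1 / w))"

lemma conj_vec_carrier [simp]: "conj_vec a \<in> carrier_vec t"
  by (simp add: conj_vec_def)

lemma ind_vec_carrier [simp]: "ind_vec a s j \<in> carrier_vec t"
  by (simp add: ind_vec_def)

lemma frob_shift_carrier [simp]: "frob_shift q t x \<in> carrier_vec t"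
  by (simp add: frob_shift_def)

lemma frob_shift_dim [simp]: "dim_vec (frob_shift q t x) = t"
  by (simp add: frob_shift_def)

lemma frob_shift_pow_carrier [simp]:
  "x \<in> carrier_vec t \<Longrightarrow> (frob_shift q t ^^ i) x \<in> carrier_vec t"
  by (cases i) auto

lemma frob_shift_Suc: "Suc m < t \<Longrightarrow> frob_shift q t x $ Suc m = (x $ m) ^ q"
  by (simp add: frob_shift_def)

lemma frob_shift_0: "frob_shift q t x $ 0 = (x $ (t - 1)) ^ q"
  using t_gt by (simp add: frob_shift_def)

lemma frob_shift_eqI:
  assumes "y \<in> carrier_vec t" "y $ 0 = (x $ (t - 1)) ^ q"
    "\<And>m. Suc m < t \<Longrightarrow> y $ Suc m = (x $ m) ^ q"
  shows "frob_shift q t x = y"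
proof (rule eq_vecI)
  fix i assume "i < dim_vec y"
  then show "frob_shift q t x $ i = y $ i"
    using assms by (cases i) (auto simp: frob_shift_Suc frob_shift_0)
qed (use assms in \<open>auto simp: frob_shift_def\<close>)

lemma frob_shift_smult:
  "x \<in> carrier_vec t \<Longrightarrow> frob_shift q t (c \<cdot>\<^sub>v x) = c ^ q \<cdot>\<^sub>v frob_shift q t (x :: 'a vec)"
proof (rule frob_shift_eqI)
  assume x: "x \<in> carrier_vec t"
  show "(c ^ q \<cdot>\<^sub>v frob_shift q t x) $ 0 = ((c \<cdot>\<^sub>v x) $ (t - 1)) ^ q"
    using x t_gt frob_shift_0[of x] by (simp add: power_mult_distrib)
  fix m assume "Suc m < t"
  then show "(c ^ q \<cdot>\<^sub>v frob_shift q t x) $ Suc m = ((c \<cdot>\<^sub>v x) $ m) ^ q"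
    using x frob_shift_Suc[of m x] \<open>Suc m < t\<close> by (simp add: power_mult_distrib)
qed simp

text \<open>The shift is only semilinear; it maps a point onto a whole point because every scalar is
  a \<open>q\<close>-th power.\<close>

lemma sigma_pg_point:
  assumes "(x :: 'a vec) \<in> carrier_vec t"
  shows "sigma q t (pg_point t x) = pg_point t (frob_shift q t x)"
proof -
  have "sigma q t (pg_point t x) = {c ^ q \<cdot>\<^sub>v frob_shift q t x | c. True}"
    unfolding sigma_def pg_point_eq[OF assms] setcompr_eq_image image_image frob_shift_smult[OF assms] ..
  also have "\<dots> = {c \<cdot>\<^sub>v frob_shift q t x | c. True}"
  proof -
    have "\<exists>d. c = d ^ q" for c :: 'a using power_q_surj[of c] by metis
    then show ?thesis by (auto; metis)
  qed
  finally show ?thesis by (simp add: pg_point_eq)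
qed

lemma sigma_pow_pg_point:
  assumes "(x :: 'a vec) \<in> carrier_vec t"
  shows "(sigma q t ^^ i) (pg_point t x) = pg_point t ((frob_shift q t ^^ i) x)"
  by (induction i) (use assms in \<open>auto simp: sigma_pg_point\<close>)

lemma frob_shift_conj_vec: "frob_shift q t (conj_vec a) = conj_vec a"
proof (rule frob_shift_eqI)
  have "a ^ (q ^ Suc (t - 1)) = a" using t_gt by simp
  then show "conj_vec a $ 0 = (conj_vec a $ (t - 1)) ^ q"
    using t_gt unfolding power_q_Suc by (simp add: conj_vec_def)
next
  fix m assume "Suc m < t"
  then show "conj_vec a $ Suc m = (conj_vec a $ m) ^ q"
    unfolding conj_vec_def using power_q_Suc by (simp del: power_Suc)
qed simp

lemma conj_vec_nonzero: "a \<noteq> 0 \<Longrightarrow> conj_vec a \<noteq> 0\<^sub>v t"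
proof
  assume "a \<noteq> 0" "conj_vec a = 0\<^sub>v t"
  then have "conj_vec a $ 0 = 0" using t_gt by simp
  then show False using \<open>a \<noteq> 0\<close> t_gt by (simp add: conj_vec_def)
qed

lemma conj_pt_subgeom: "a \<noteq> 0 \<Longrightarrow> pg_point t (conj_vec a) \<in> subgeom q t"
  by (simp add: subgeom_def pg_points_iff conj_vec_nonzero sigma_pg_point frob_shift_conj_vec)

text \<open>A fixed point only gives a vector that the shift multiplies by some \<open>c\<close>.
  One turn through all coordinates shows that \<open>c\<close> has norm 1, and Hilbert 90 supplies
  the rescaling that removes \<open>c\<close>.\<close>

lemma subgeom_conj_vec:
  assumes "P \<in> subgeom q t"
  obtains a where "a \<noteq> 0" "P = pg_point t (conj_vec a)"
proof -
  obtain x :: "'a vec" where x: "x \<in> carrier_vec t" "x \<noteq> 0\<^sub>v t" "P = pg_point t x"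
    using assms unfolding subgeom_def pg_points_def by auto
  have "pg_point t (frob_shift q t x) = pg_point t x"
    using assms x by (simp add: subgeom_def sigma_pg_point)
  then obtain c where c: "c \<noteq> 0" "frob_shift q t x = c \<cdot>\<^sub>v x"
    using pg_point_eq_iff x(1) frob_shift_carrier by metis
  have step: "(x $ m) ^ q = c * x $ Suc m" if "Suc m < t" for m
    using arg_cong[OF c(2), of "\<lambda>y. y $ Suc m"] that x(1) by (simp add: frob_shift_Suc)
  have last: "(x $ (t - 1)) ^ q = c * x $ 0"
    using arg_cong[OF c(2), of "\<lambda>y. y $ 0"] t_gt x(1) by (simp add: frob_shift_0)
  have pow: "(x $ 0) ^ (q ^ m) = c ^ (\<Sum>i<m. q ^ i) * x $ m" if "m < t" for m
    using that
  proof (induction m)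
    case (Suc m)
    have "(x $ 0) ^ (q ^ Suc m) = (c ^ (\<Sum>i<m. q ^ i)) ^ q * (x $ m) ^ q"
      unfolding power_q_Suc using Suc by (simp add: power_mult_distrib)
    also have "\<dots> = c ^ ((\<Sum>i<m. q ^ i) * q + 1) * x $ Suc m"
      using step[OF Suc.prems] by (simp add: power_mult power_add)
    also have "(\<Sum>i<m. q ^ i) * q + 1 = (\<Sum>i<Suc m. q ^ i)"
      unfolding sum.lessThan_Suc_shift by (simp add: sum_distrib_left mult.commute)
    finally show ?case .
  qed simp
  have x0: "x $ 0 \<noteq> 0"
  proof
    assume 0: "x $ 0 = 0"
    have "x $ m = 0" if "m < t" for m
    proof -
      have "(x $ 0) ^ (q ^ m) = 0" unfolding 0 using q_gt_1 by (simp add: power_0_left)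
      then show ?thesis using pow[OF that] c(1) by auto
    qed
    then have "x = 0\<^sub>v t" using x(1) by (intro eq_vecI) auto
    then show False using x(2) by simp
  qed
  \<comment> \<open>Closing the cycle: the last coordinate shifted once more returns to coordinate 0
    and leaves the full norm of \<open>c\<close>.\<close>
  have "x $ 0 = ((x $ 0) ^ (q ^ (t - 1))) ^ q"
    using power_q_Suc[of "x $ 0" "t - 1"] t_gt by simp
  also have "\<dots> = (c ^ (\<Sum>i<t - 1. q ^ i)) ^ q * (x $ (t - 1)) ^ q"
    using pow[of "t - 1"] t_gt by (simp add: power_mult_distrib)
  also have "\<dots> = c ^ ((\<Sum>i<t - 1. q ^ i) * q + 1) * x $ 0"
    using last by (simp add: power_mult power_add)
  also have "(\<Sum>i<t - 1. q ^ i) * q + 1 = (\<Sum>i<Suc (t - 1). q ^ i)"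
    unfolding sum.lessThan_Suc_shift by (simp add: sum_distrib_left mult.commute)
  also have "Suc (t - 1) = t" using t_gt by simp
  finally have "c ^ (\<Sum>i<t. q ^ i) = 1" using x0 by simp
  \<comment> \<open>The reciprocal, because scaling \<open>x\<close> by \<open>y\<close> multiplies
    \<open>c\<close> by \<open>y ^ (q - 1)\<close>.\<close>
  then have "(1 / c) ^ (\<Sum>i<t. q ^ i) = 1" by (simp add: power_one_over)
  from hilbert_90[OF card_a q_gt_1 _ this] c(1)
  obtain y where y: "y \<noteq> 0" "y ^ (q - 1) = 1 / c" by auto
  have yq: "y ^ q = y / c"
  proof -
    have "y ^ q = y * y ^ (q - 1)" using q_gt_1 by (cases q) auto
    then show ?thesis using y by simp
  qed
  have "y * x $ m = (y * x $ 0) ^ (q ^ m)" if "m < t" for m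
    using that
  proof (induction m)
    case (Suc m)
    have "y * x $ Suc m = y / c * (c * x $ Suc m)" using c(1) by simp
    also have "\<dots> = (y * x $ m) ^ q"
      using step[OF Suc.prems] yq by (simp add: power_mult_distrib)
    finally show ?case unfolding power_q_Suc using Suc by simp
  qed simp
  note pows = this
  have "y \<cdot>\<^sub>v x = conj_vec (y * x $ 0)"
  proof (rule eq_vecI)
    fix m assume "m < dim_vec (conj_vec (y * x $ 0))"
    then have m: "m < t" by (simp add: conj_vec_def)
    have "(y \<cdot>\<^sub>v x) $ m = y * x $ m" using m x(1) by simp
    then show "(y \<cdot>\<^sub>v x) $ m = conj_vec (y * x $ 0) $ m"
      unfolding pows[OF m] using m by (simp only: conj_vec_def index_vec)
  qed (use x(1) in \<open>simp add: conj_vec_def\<close>)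
  then have "P = pg_point t (conj_vec (y * x $ 0))"
    using pg_point_smult[OF x(1) y(1)] x(3) by simp
  then show ?thesis using that[of "y * x $ 0"] y x0 by simp
qed

lemma pt_in_subgeom: "w \<noteq> 0 \<Longrightarrow> pt w \<in> subgeom q t"
  by (simp add: pt_def conj_pt_subgeom)

lemma subgeom_eq: "subgeom q t = pt ` (UNIV - {0})"
proof
  show "(subgeom q t :: 'a vec set set) \<subseteq> pt ` (UNIV - {0})"
  proof
    fix P :: "'a vec set" assume "P \<in> subgeom q t"
    then obtain a where "a \<noteq> 0" "P = pg_point t (conj_vec a)" by (rule subgeom_conj_vec)
    then show "P \<in> pt ` (UNIV - {0})"
      by (intro image_eqI[of _ _ "1 / a"]) (auto simp: pt_def)
  qed
qed (auto intro!: pt_in_subgeom)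

text \<open>Coordinates 0 and 1 express the scalar as \<open>a / b\<close> and as
  \<open>(a / b) ^ q\<close>. Conversely, a quotient fixed by \<open>q\<close>-th powering is the
  same scalar in every coordinate.\<close>

lemma conj_pt_eq_iff:
  assumes "a \<noteq> 0" "b \<noteq> 0"
  shows "pg_point t (conj_vec a) = pg_point t (conj_vec b) \<longleftrightarrow> (a / b) ^ q = a / b"
proof
  assume "pg_point t (conj_vec a) = pg_point t (conj_vec b)"
  then obtain c where c: "conj_vec a = c \<cdot>\<^sub>v conj_vec b"
    using pg_point_eq_iff[of "conj_vec a" t "conj_vec b"] by auto
  have "a = c * b" "a ^ q = c * b ^ q"
    using arg_cong[OF c, of "\<lambda>y. y $ 0"] arg_cong[OF c, of "\<lambda>y. y $ 1"] t_gt
    by (simp_all add: conj_vec_def)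
  then have "c = a / b" "c = a ^ q / b ^ q" using assms by auto
  then show "(a / b) ^ q = a / b" by (simp add: power_divide)
next
  assume "(a / b) ^ q = a / b"
  then have "(a / b) ^ (q ^ m) = a / b" for m using power_q_fixed[of "a / b" 1 m] by simp
  then have "a ^ (q ^ m) = a / b * b ^ (q ^ m)" for m
    using assms by (simp add: power_divide field_simps)
  then have "conj_vec a = (a / b) \<cdot>\<^sub>v conj_vec b"
    unfolding conj_vec_def by (intro eq_vecI) auto
  then show "pg_point t (conj_vec a) = pg_point t (conj_vec b)"
    using assms by (simp add: pg_point_smult)
qed

lemma pt_eq_iff:
  assumes "v \<noteq> 0" "w \<noteq> 0"
  shows "pt v = pt w \<longleftrightarrow> (v / w) ^ q = v / w"
proof -
  have "pt w = pt v \<longleftrightarrow> (v / w) ^ q = v / w"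
    using conj_pt_eq_iff[of "1 / w" "1 / v"] assms unfolding pt_def by simp
  then show ?thesis by metis
qed

end


section \<open>Normal rational curves through the indicator points\<close>

lemma proportional_pairs:
  fixes x y x' y' :: "'a::field"
  assumes "y * x' = x * y'" "(x, y) \<noteq> (0, 0)" "(x', y') \<noteq> (0, 0)"
  obtains c where "c \<noteq> 0" "x' = c * x" "y' = c * y"
proof (cases "x = 0")
  case True
  then have "y \<noteq> 0" "x' = 0" "y' \<noteq> 0" using assms by auto
  then show ?thesis using that[of "y' / y"] True by simp
next
  case False
  then have y': "y' = x' / x * y" using assms(1) by (simp add: field_simps)
  then have "x' \<noteq> 0" using assms(3) by auto
  then show ?thesis using that[of "x' / x"] False y' by simp
qed

context big_field
begin

definition block :: "'a \<Rightarrow> 'a \<Rightarrow> 'a vec set set" where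
  "block w w' = {pt (A * w + B * w') | A B. A ^ q = A \<and> B ^ q = B \<and> (A, B) \<noteq> (0, 0)}"

end

text \<open>The last two assumptions say that \<open>w' / w\<close> generates the subfield with
  \<open>q ^ s\<close> elements; this is what minimality of \<open>s\<close> provides.\<close>

locale generating_pair = big_field q t ty for q t and ty :: "'a::{field,finite} itself" +
  fixes w w' :: 'a and s :: nat
  assumes w0: "w \<noteq> 0" and w'0: "w' \<noteq> 0" and s_dvd: "s dvd t" and s_gt: "s > 1"
    and ratio_fixed: "(w' / w) ^ (q ^ s) = w' / w"
    and ratio_distinct: "\<And>i j. i < s \<Longrightarrow> j < s \<Longrightarrow> i \<noteq> j \<Longrightarrow> (w' / w) ^ (q ^ i) \<noteq> (w' / w) ^ (q ^ j)"
begin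

lemma s_le: "s \<le> t"
  using s_dvd t_gt by (intro dvd_imp_le) auto

lemma ratio_not_fixed: "(w' / w) ^ q \<noteq> w' / w"
  using ratio_distinct[of 1 0] s_gt by simp

text \<open>Dependence of two successive rows of conjugates would make a conjugate of
  \<open>w' / w\<close>, hence \<open>w' / w\<close> itself, fixed by \<open>q\<close>-th
  powering.\<close>

lemma conjugates_independent:
  assumes "x * w ^ (q ^ m) + y * w' ^ (q ^ m) = 0" "x * w ^ (q ^ Suc m) + y * w' ^ (q ^ Suc m) = 0"
  shows "x = 0 \<and> y = 0"
proof -
  have "y = 0"
  proof (rule ccontr)
    assume y: "y \<noteq> 0"
    have *: "(w' / w) ^ (q ^ n) = - x / y" if "x * w ^ (q ^ n) + y * w' ^ (q ^ n) = 0" for n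
    proof -
      have "y * w' ^ (q ^ n) = - x * w ^ (q ^ n)" using that by (simp add: eq_neg_iff_add_eq_0 add.commute)
      then show ?thesis using y w0 by (simp add: power_divide field_simps)
    qed
    have "((w' / w) ^ q) ^ (q ^ m) = (w' / w) ^ (q ^ m)"
      using *[OF assms(1)] *[OF assms(2)] by (simp flip: power_mult)
    then show False using power_qm_inj ratio_not_fixed by blast
  qed
  then show ?thesis using assms(1) w0 by simp
qed

text \<open>The linear forms \<open>u + e ^ (q ^ i) * v\<close> are normalised so that the
  parameters \<open>(1, 0)\<close> and \<open>(0, 1)\<close> give the two points. At the zero of
  form number \<open>j\<close> only the coordinates lacking that factor survive, which gives an
  indicator point.\<close>

lemma curve_exists:
  "\<exists>C. normal_rational_curve t (s - 1) C \<and> pt w \<in> C \<and> pt w' \<in> C \<and>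
     (\<forall>j<s. pg_point t (ind_vec (1 / w) s j) \<in> C)"
proof -
  define e where "e = w' / w"
  have e0: "e \<noteq> 0" using w0 w'0 by (simp add: e_def)
  define F where "F = (\<lambda>m u v. (1 / w) ^ (q ^ m) * (\<Prod>i\<in>{..<s} - {m mod s}. 1 * u + e ^ (q ^ i) * v))"
  define C where "C = {pg_point t (vec t (\<lambda>m. F m u v)) | u v. (u, v) \<noteq> (0, 0)}"
  have in_C: "pg_point t (vec t (\<lambda>m. F m u v)) \<in> C" if "(u, v) \<noteq> (0, 0)" for u v
    unfolding C_def using that by blast
  have F0: "F m (- (e ^ (q ^ j))) 1 = 0" if "j < s" "m mod s \<noteq> j" for m j
  proof -
    have "(\<Prod>i\<in>{..<s} - {m mod s}. 1 * (- (e ^ (q ^ j))) + e ^ (q ^ i) * 1) = 0"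
      using that by (intro prod_zero) (auto intro!: bexI[of _ j])
    then show ?thesis unfolding F_def by simp
  qed
  define k where "k j = (\<Prod>i\<in>{..<s} - {j}. 1 * (- (e ^ (q ^ j))) + e ^ (q ^ i) * 1)" for j
  have k0: "k j \<noteq> 0" if "j < s" for j
    unfolding k_def using ratio_distinct[of _ j] that by (auto simp: e_def)
  have F1: "F m (- (e ^ (q ^ j))) 1 = k j * (1 / w) ^ (q ^ m)" if "m mod s = j" for m j
    unfolding F_def k_def that by simp
  have forms: "binary_form (s - 1) (F m)" for m
  proof -
    have "card ({..<s} - {m mod s}) = s - 1" using s_gt by simp
    then show ?thesis
      using binary_form_smult[OF binary_form_prod_linear[of "{..<s} - {m mod s}" "\<lambda>i. 1" "\<lambda>i. e ^ (q ^ i)"]]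
      unfolding F_def by simp
  qed
  have nrc: "normal_rational_curve t (s - 1) C"
    unfolding C_def
  proof (rule normal_rational_curveI[OF forms])
    show "s - 1 < t" using s_le s_gt by simp
    fix j assume "j \<le> s - 1"
    then have j: "j < s" using s_gt by simp
    have "F i (- (e ^ (q ^ j))) 1 = 0" if "i \<le> s - 1" "i \<noteq> j" for i
      using F0[OF j, of i] that s_gt by simp
    moreover have "F j (- (e ^ (q ^ j))) 1 \<noteq> 0" using F1[of j j] k0[OF j] j w0 by simp
    ultimately show "\<exists>u v. F j u v \<noteq> 0 \<and> (\<forall>i\<le>s - 1. i \<noteq> j \<longrightarrow> F i u v = 0)" by blast
  qed
  have "vec t (\<lambda>m. F m 1 0) = conj_vec (1 / w)"
    unfolding conj_vec_def F_def by (intro eq_vecI) auto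
  then have "pt w \<in> C" unfolding pt_def using in_C[of 1 0] by simp
  moreover have "pt w' \<in> C"
  proof -
    define L where "L = (\<Prod>i<s. e ^ (q ^ i))"
    have L0: "L \<noteq> 0" using e0 by (simp add: L_def)
    \<comment> \<open>The coordinate is the product of all \<open>s\<close> conjugates divided by
      \<open>e ^ (q ^ m)\<close>, and this divisor turns \<open>1 / w\<close> into
      \<open>1 / w'\<close>. Reading the index modulo \<open>s\<close> is harmless by
      \<open>ratio_fixed\<close>.\<close>
    have "F m 0 1 = L * (1 / w') ^ (q ^ m)" for m
    proof -
      have "L = e ^ (q ^ (m mod s)) * (\<Prod>i\<in>{..<s} - {m mod s}. e ^ (q ^ i))"
        unfolding L_def using s_gt by (intro prod.remove) auto
      also have "e ^ (q ^ (m mod s)) = e ^ (q ^ m)"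
        using power_q_mod[OF ratio_fixed] unfolding e_def .
      finally show ?thesis
        unfolding F_def e_def using w0 w'0 by (simp add: power_divide)
    qed
    then have "vec t (\<lambda>m. F m 0 1) = L \<cdot>\<^sub>v conj_vec (1 / w')"
      unfolding conj_vec_def by (intro eq_vecI) auto
    then have "pt w' = pg_point t (vec t (\<lambda>m. F m 0 1))"
      unfolding pt_def using L0 by (simp add: pg_point_smult)
    then show ?thesis using in_C[of 0 1] by simp
  qed
  moreover have "pg_point t (ind_vec (1 / w) s j) \<in> C" if j: "j < s" for j
  proof -
    have "vec t (\<lambda>m. F m (- (e ^ (q ^ j))) 1) = k j \<cdot>\<^sub>v ind_vec (1 / w) s j"
      unfolding ind_vec_def using F0[OF j] F1 by (intro eq_vecI) auto
    then have "pg_point t (ind_vec (1 / w) s j) = pg_point t (vec t (\<lambda>m. F m (- (e ^ (q ^ j))) 1))"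
      using k0[OF j] by (simp add: pg_point_smult)
    then show ?thesis using in_C[of "- (e ^ (q ^ j))" 1] by simp
  qed
  ultimately show ?thesis using nrc by blast
qed

text \<open>The block is unique without any appeal to uniqueness of the curve. The reciprocal
  coordinates are linear in the parameters up to a common factor, so along the curve they are
  combinations of those of the two given points; membership in the subgeometry forces the
  coefficients to be fixed by \<open>q\<close>-th powering.\<close>

lemma curve_subgeom:
  assumes nrc: "normal_rational_curve t (s - 1) C" and P: "pt w \<in> C" and Q: "pt w' \<in> C"
    and X: "\<And>j. j < s \<Longrightarrow> pg_point t (ind_vec (1 / w) s j) \<in> C"
  shows "C \<inter> subgeom q t = block w w'"
proof -
  obtain F where F: "\<And>m. m < t \<Longrightarrow> binary_form (s - 1) (F m)"
    and C: "C = {pg_point t (vec t (\<lambda>m. F m u v)) | u v. (u, v) \<noteq> (0, 0)}"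
    using normal_rational_curve_forms[OF nrc] by blast
  have param: "\<exists>u v k. (u, v) \<noteq> (0, 0) \<and> k \<noteq> 0 \<and> (\<forall>m<t. F m u v = k * x $ m)"
    if "pg_point t x \<in> C" "x \<in> carrier_vec t" for x
  proof -
    obtain u v where uv: "(u, v) \<noteq> (0, 0)" "pg_point t (vec t (\<lambda>m. F m u v)) = pg_point t x"
      using \<open>pg_point t x \<in> C\<close> unfolding C by auto
    then obtain k where k: "k \<noteq> 0" "vec t (\<lambda>m. F m u v) = k \<cdot>\<^sub>v x"
      using pg_point_eq_iff[of "vec t (\<lambda>m. F m u v)" t x] \<open>x \<in> carrier_vec t\<close> by auto
    have "F m u v = k * x $ m" if "m < t" for m
      using arg_cong[OF k(2), of "\<lambda>y. y $ m"] that \<open>x \<in> carrier_vec t\<close> by simp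
    then show ?thesis using uv(1) k(1) by blast
  qed
  have "\<forall>j. \<exists>u v k. j < s \<longrightarrow> (u, v) \<noteq> (0, 0) \<and> k \<noteq> 0 \<and> (\<forall>m<t. F m u v = k * ind_vec (1 / w) s j $ m)"
    using param[OF X] by simp
  then obtain a b g where abg: "\<forall>j. j < s \<longrightarrow> (a j, b j) \<noteq> (0, 0) \<and> g j \<noteq> 0 \<and>
      (\<forall>m<t. F m (a j) (b j) = g j * ind_vec (1 / w) s j $ m)"
    unfolding choice_iff by (elim exE)
  have ab: "(a j, b j) \<noteq> (0, 0)" "g j \<noteq> 0"
    "\<And>m. m < t \<Longrightarrow> F m (a j) (b j) = g j * (if m mod s = j then (1 / w) ^ (q ^ m) else 0)"
    if "j < s" for j
    using abg that by (auto simp: ind_vec_def)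
  obtain p1 p2 kp where p: "(p1, p2) \<noteq> (0, 0)" "kp \<noteq> 0" "\<And>m. m < t \<Longrightarrow> F m p1 p2 = kp * (1 / w) ^ (q ^ m)"
    using param[OF P[unfolded pt_def]] unfolding conj_vec_def by auto
  obtain r1 r2 kr where r: "(r1, r2) \<noteq> (0, 0)" "kr \<noteq> 0" "\<And>m. m < t \<Longrightarrow> F m r1 r2 = kr * (1 / w') ^ (q ^ m)"
    using param[OF Q[unfolded pt_def]] unfolding conj_vec_def by auto
  \<comment> \<open>Proportional parameters give the same point, but coordinate \<open>i\<close>
    vanishes at one of the two indicator points and not at the other.\<close>
  have nonprop: "b i * a j \<noteq> a i * b j" if ij: "i < s" "j < s" "i \<noteq> j" for i j
  proof
    assume "b i * a j = a i * b j"
    then obtain c where c: "c \<noteq> 0" "a j = c * a i" "b j = c * b i"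
      using proportional_pairs[OF _ ab(1)[OF ij(1)] ab(1)[OF ij(2)]] by blast
    have i: "i < t" using ij s_le by simp
    have "F i (a j) (b j) = c ^ (s - 1) * F i (a i) (b i)"
      unfolding c by (rule binary_form_scale[OF F[OF i]])
    then show False using ab(2,3)[of i] ab(3)[of j i] i ij c(1) w0 by simp
  qed
  \<comment> \<open>Proportional parameters would give equal points; coordinates 0 and 1 then
    contradict \<open>ratio_not_fixed\<close>.\<close>
  have det: "p1 * r2 - p2 * r1 \<noteq> 0"
  proof
    assume "p1 * r2 - p2 * r1 = 0"
    then have "p2 * r1 = p1 * r2" by simp
    then obtain c where c: "c \<noteq> 0" "r1 = c * p1" "r2 = c * p2"
      using proportional_pairs[OF _ p(1) r(1)] by blast
    have "kr * (1 / w') ^ (q ^ m) = c ^ (s - 1) * (kp * (1 / w) ^ (q ^ m))" if "m < t" for m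
      using binary_form_scale[OF F[OF that], of c p1 p2] p(3)[OF that] r(3)[OF that] unfolding c by simp
    then have ratio: "(w' / w) ^ (q ^ m) = kr / (c ^ (s - 1) * kp)" if "m < t" for m
      using that w0 w'0 p(2) r(2) c(1) by (simp add: power_divide field_simps)
    show False using ratio[of 0] ratio[of 1] t_gt ratio_not_fixed by simp
  qed
  define L where "L i u v = b i * u - a i * v" for i u v
  define La where "La u v = (\<Prod>i<s. L i u v)" for u v
  \<comment> \<open>Coordinate \<open>m\<close> vanishes at every indicator point except number
    \<open>m mod s\<close>: these are \<open>s - 1\<close> zeros of a form of degree
    \<open>s - 1\<close>.\<close>
  have "\<exists>k. \<forall>u v. F m u v = k * (\<Prod>i\<in>{..<s} - {m mod s}. b i * u - a i * v)" if m: "m < t" for m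
  proof (rule binary_form_zeros)
    have "card ({..<s} - {m mod s}) = s - 1" using s_gt by simp
    then show "binary_form (card ({..<s} - {m mod s})) (F m)" using F[OF m] by simp
  qed (use ab m nonprop in auto)
  then obtain k where k: "\<And>m u v. m < t \<Longrightarrow> F m u v = k m * (\<Prod>i\<in>{..<s} - {m mod s}. L i u v)"
    unfolding L_def by metis
  \<comment> \<open>Supplying the missing factor makes the product common to all coordinates, so
    coordinate \<open>m\<close> is proportional to \<open>k m / L (m mod s) u v\<close> wherever
    that form is nonzero.\<close>
  have FL: "F m u v * L (m mod s) u v = k m * La u v" if "m < t" for m u v
  proof -
    have "La u v = L (m mod s) u v * (\<Prod>i\<in>{..<s} - {m mod s}. L i u v)"
      unfolding La_def using s_gt by (intro prod.remove) auto
    then show ?thesis using k[OF that] by simp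
  qed
  have La0: "La u v \<noteq> 0" if nz: "\<And>m. m < t \<Longrightarrow> F m u v \<noteq> 0" for u v
  proof -
    have "L i u v \<noteq> 0" if "i < s" for i
    proof -
      \<comment> \<open>An index from another residue class than \<open>i\<close>, so that
        \<open>L i\<close> is a factor of coordinate \<open>m\<close>; it exists because
        \<open>s > 1\<close>.\<close>
      define m where "m = (if i = 0 then 1 else 0 :: nat)"
      have m: "m < s" "m < t" "m \<noteq> i" using s_gt s_le by (auto simp: m_def)
      have "(\<Prod>i\<in>{..<s} - {m mod s}. L i u v) \<noteq> 0" using nz[OF m(2)] k[OF m(2), of u v] by auto
      then show ?thesis using that m by auto
    qed
    then show ?thesis unfolding La_def by simp
  qed
  have k0: "k m \<noteq> 0" if "m < t" for m using p(2,3) k w0 that by fastforce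
  \<comment> \<open>Scalars independent of \<open>m\<close>: apart from them, the forms take the
    conjugates of \<open>w\<close> and \<open>w'\<close> as values at the two parameters, with the
    same \<open>k m\<close> in both cases.\<close>
  define rho rho' where "rho = La p1 p2 / kp" and "rho' = La r1 r2 / kr"
  have rho0: "rho \<noteq> 0" "rho' \<noteq> 0"
    using La0[of p1 p2] La0[of r1 r2] p r w0 w'0 by (auto simp: rho_def rho'_def)
  have Lp: "L (m mod s) p1 p2 = k m * rho * w ^ (q ^ m)" if "m < t" for m
    using FL[OF that, of p1 p2] p(2) p(3)[OF that] w0 by (simp add: rho_def power_divide field_simps)
  have Lr: "L (m mod s) r1 r2 = k m * rho' * w' ^ (q ^ m)" if "m < t" for m
    using FL[OF that, of r1 r2] r(2) r(3)[OF that] w'0 by (simp add: rho'_def power_divide field_simps)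
  have L_comb: "L (m mod s) (x * p1 + y * r1) (x * p2 + y * r2)
      = k m * (x * rho * w ^ (q ^ m) + y * rho' * w' ^ (q ^ m))" if "m < t" for m x y
  proof -
    have "L (m mod s) (x * p1 + y * r1) (x * p2 + y * r2)
        = x * L (m mod s) p1 p2 + y * L (m mod s) r1 r2"
      by (simp add: L_def algebra_simps)
    then show ?thesis unfolding Lp[OF that] Lr[OF that] by (simp add: algebra_simps)
  qed
  show ?thesis
  proof (intro equalityI subsetI)
    fix Y assume Y: "Y \<in> C \<inter> subgeom q t"
    then obtain z' where z': "z' \<noteq> 0" "Y = pg_point t (conj_vec z')"
      using subgeom_conj_vec[of Y] by blast
    obtain u v kz where uv: "kz \<noteq> 0" "\<And>m. m < t \<Longrightarrow> F m u v = kz * z' ^ (q ^ m)"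
      using param[of "conj_vec z'"] Y z'(2) unfolding conj_vec_def by auto
    have La_uv: "La u v \<noteq> 0" by (rule La0) (use uv z' in simp)
    \<comment> \<open>Cramer's rule for \<open>(u, v)\<close> in the basis of the two prescribed
      parameters.\<close>
    define x y where "x = (u * r2 - v * r1) / (p1 * r2 - p2 * r1)"
      and "y = (p1 * v - p2 * u) / (p1 * r2 - p2 * r1)"
    have "x * p1 + y * r1 = u * (p1 * r2 - p2 * r1) / (p1 * r2 - p2 * r1)"
      unfolding x_def y_def by (simp add: add_divide_distrib[symmetric] algebra_simps)
    moreover have "x * p2 + y * r2 = v * (p1 * r2 - p2 * r1) / (p1 * r2 - p2 * r1)"
      unfolding x_def y_def by (simp add: add_divide_distrib[symmetric] algebra_simps)
    ultimately have xy: "x * p1 + y * r1 = u" "x * p2 + y * r2 = v" using det by simp_all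
    define A B z where "A = x * rho * kz / La u v" and "B = y * rho' * kz / La u v" and "z = 1 / z'"
    have AB: "A * w ^ (q ^ m) + B * w' ^ (q ^ m) = z ^ (q ^ m)" if m: "m < t" for m
    proof -
      have "kz * z' ^ (q ^ m) * (k m * (x * rho * w ^ (q ^ m) + y * rho' * w' ^ (q ^ m))) = k m * La u v"
        using FL[OF m, of u v] L_comb[OF m, of x y] unfolding xy uv(2)[OF m] by simp
      then have "kz * z' ^ (q ^ m) * (x * rho * w ^ (q ^ m) + y * rho' * w' ^ (q ^ m)) = La u v"
        using k0[OF m] by (simp add: mult_ac)
      moreover have "A * w ^ (q ^ m) + B * w' ^ (q ^ m)
          = kz * (x * rho * w ^ (q ^ m) + y * rho' * w' ^ (q ^ m)) / La u v"
        unfolding A_def B_def by (simp add: add_divide_distrib[symmetric] algebra_simps)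
      ultimately have "(A * w ^ (q ^ m) + B * w' ^ (q ^ m)) * z' ^ (q ^ m) = 1"
        using La_uv by (simp add: mult_ac)
      then show ?thesis
        unfolding z_def power_divide power_one using z'(1) by (simp add: eq_divide_eq)
    qed
    \<comment> \<open>Raise the relation for \<open>m\<close> to the power \<open>q\<close> and
      compare it with the relation for \<open>Suc m\<close>.\<close>
    have "(A ^ q - A) * w ^ (q ^ Suc m) + (B ^ q - B) * w' ^ (q ^ Suc m) = 0" if "Suc m < t" for m
    proof -
      have "z ^ (q ^ Suc m) = (A * w ^ (q ^ m) + B * w' ^ (q ^ m)) ^ q"
        unfolding power_q_Suc using AB[of m] that by simp
      also have "\<dots> = A ^ q * w ^ (q ^ Suc m) + B ^ q * w' ^ (q ^ Suc m)"
        unfolding power_q_Suc using power_add_q[of _ _ 1] by (simp add: power_mult_distrib)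
      finally show ?thesis using AB[OF that] by (simp add: algebra_simps)
    qed
    \<comment> \<open>The relations with exponents \<open>q\<close> and \<open>q ^ 2\<close> are
      used; coordinate 2 exists since \<open>t > 2\<close>.\<close>
    from conjugates_independent[OF this[of 0] this[of "Suc 0"]] t_gt
    have "A ^ q = A" "B ^ q = B" by simp_all
    moreover have z: "z = A * w + B * w'" using AB[of 0] t_gt by simp
    moreover have "Y = pt z" unfolding z'(2) pt_def z_def by simp
    moreover have "(A, B) \<noteq> (0, 0)" using z z'(1) by (auto simp: z_def)
    ultimately show "Y \<in> block w w'" unfolding block_def by blast
  next
    fix Y assume "Y \<in> block w w'"
    then obtain A B where AB: "A ^ q = A" "B ^ q = B" "(A, B) \<noteq> (0, 0)" "Y = pt (A * w + B * w')"
      unfolding block_def by blast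
    define z where "z = A * w + B * w'"
    have zm: "A * w ^ (q ^ m) + B * w' ^ (q ^ m) = z ^ (q ^ m)" for m
      unfolding z_def power_add_q power_mult_distrib
      using power_q_fixed[of A 1 m] power_q_fixed[of B 1 m] AB(1,2) by simp
    have z0: "z \<noteq> 0"
    proof
      assume "z = 0"
      then have "A * w ^ (q ^ m) + B * w' ^ (q ^ m) = 0" for m
        using zm[of m] q_gt_1 by (simp add: power_0_left)
      from conjugates_independent[OF this this] show False using AB(3) by simp
    qed
    \<comment> \<open>Dividing by \<open>rho\<close> and \<open>rho'\<close> makes the linear forms
      take the conjugates of \<open>z\<close> as values, up to \<open>k m\<close>.\<close>
    define u v where "u = A / rho * p1 + B / rho' * r1" and "v = A / rho * p2 + B / rho' * r2"
    have Luv: "L (m mod s) u v = k m * z ^ (q ^ m)" if "m < t" for m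
      unfolding u_def v_def L_comb[OF that] zm[symmetric] using rho0 by simp
    have "L i u v \<noteq> 0" if "i < s" for i
      using Luv[of i] that s_le k0[of i] z0 by simp
    then have La_uv: "La u v \<noteq> 0" unfolding La_def by simp
    have "F m u v = La u v * (1 / z) ^ (q ^ m)" if "m < t" for m
      using FL[OF that, of u v] Luv[OF that] k0[OF that] z0 by (simp add: power_divide field_simps)
    then have "vec t (\<lambda>m. F m u v) = La u v \<cdot>\<^sub>v conj_vec (1 / z)"
      unfolding conj_vec_def by (intro eq_vecI) auto
    then have "pt z = pg_point t (vec t (\<lambda>m. F m u v))"
      unfolding pt_def using La_uv by (simp add: pg_point_smult)
    moreover have "(u, v) \<noteq> (0, 0)"
    proof
      assume "(u, v) = (0, 0)"
      then have "L 0 u v = 0" by (simp add: L_def)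
      then show False using \<open>\<And>i. i < s \<Longrightarrow> L i u v \<noteq> 0\<close> s_gt by auto
    qed
    ultimately have "pt z \<in> C" unfolding C by blast
    then show "Y \<in> C \<inter> subgeom q t" using pt_in_subgeom[OF z0] AB(4) z_def by simp
  qed
qed

end


section \<open>Desarguesian spreads and indicator points\<close>

lemma Suc_mod_eq_iff: "j < s \<Longrightarrow> Suc m mod s = Suc j mod s \<longleftrightarrow> m mod s = j" for m j s :: nat
  by (auto simp: mod_Suc)

context big_field
begin

text \<open>\<open>j\<close> is read modulo \<open>s\<close> because iterating the shift moves it
  cyclically through the residue classes.\<close>

definition supported :: "nat \<Rightarrow> nat \<Rightarrow> 'a vec \<Rightarrow> bool" where
  "supported s j x \<longleftrightarrow> (\<forall>m<t. m mod s \<noteq> j mod s \<longrightarrow> x $ m = 0)"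

text \<open>The span of all \<open>ind_vec a s j\<close> with \<open>j < s\<close>, in coordinates:
  on each residue class a vector is proportional to \<open>conj_vec a\<close>.\<close>

definition conj_space :: "'a \<Rightarrow> nat \<Rightarrow> 'a vec set" where
  "conj_space a s = {x \<in> carrier_vec t. \<exists>g. \<forall>m<t. x $ m = g (m mod s) * a ^ (q ^ m)}"

definition spread_elem :: "'a \<Rightarrow> nat \<Rightarrow> 'a vec set set" where
  "spread_elem a s = {P \<in> pg_points t. P \<subseteq> conj_space a s} \<inter> subgeom q t"

lemma supported_frob_shift:
  assumes "s dvd t" "supported s j x"
  shows "supported s (Suc j) (frob_shift q t x)"
  unfolding supported_def
proof (intro allI impI)
  fix m assume m: "m < t" "m mod s \<noteq> Suc j mod s"
  show "frob_shift q t x $ m = 0"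
  proof (cases m)
    \<comment> \<open>The shift wraps around here; the residues fit because \<open>s\<close> divides
      \<open>t\<close>.\<close>
    case 0
    have "(t - 1) mod s \<noteq> j mod s"
    proof
      assume "(t - 1) mod s = j mod s"
      then have "Suc (t - 1) mod s = Suc j mod s" by (metis mod_Suc_eq)
      then show False using m(2) 0 t_gt assms(1) by simp
    qed
    then have "x $ (t - 1) = 0" using assms(2) t_gt by (simp add: supported_def)
    then show ?thesis using frob_shift_0[of x] q_gt_1 0 by simp
  next
    case (Suc n)
    then have "n mod s \<noteq> j mod s" using m(2) by (metis mod_Suc_eq)
    then have "x $ n = 0" using assms(2) Suc m(1) by (simp add: supported_def)
    then show ?thesis using frob_shift_Suc[of n x] q_gt_1 Suc m(1) by simp
  qed
qed

lemma supported_frob_shift_pow: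
  assumes "s dvd t" "supported s 0 x"
  shows "supported s i ((frob_shift q t ^^ i) x)"
  by (induction i) (use assms supported_frob_shift in auto)

lemma frob_shift_unit_vec:
  assumes "Suc k < t"
  shows "frob_shift q t (unit_vec t k :: 'a vec) = unit_vec t (Suc k)"
  by (rule frob_shift_eqI) (use assms t_gt q_gt_1 in \<open>auto simp: unit_vec_def\<close>)

lemma frob_shift_pow_unit_vec:
  "k < t \<Longrightarrow> (frob_shift q t ^^ k) (unit_vec t 0 :: 'a vec) = unit_vec t k"
  by (induction k) (auto simp: frob_shift_unit_vec)

lemma sigma_pow_R_point:
  "k < t \<Longrightarrow> (sigma q t ^^ k) (R_point t :: 'a vec set) = pg_point t (unit_vec t k)"
  by (simp add: R_point_def sigma_pow_pg_point frob_shift_pow_unit_vec)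

lemma closed_subspace_supported: "closed_subspace t {x \<in> carrier_vec t. supported s j x}"
  unfolding closed_subspace_def supported_def by auto

text \<open>The shifts of \<open>R\<close> are the points of the unit vectors; shifting by multiples
  of \<open>s\<close> keeps those whose index is a multiple of \<open>s\<close>.\<close>

lemma pg_span_R_points:
  assumes "s dvd t" "s > 0"
  shows "pg_span t {(sigma q t ^^ (s * k)) (R_point t) | k. k < t div s}
    = {P \<in> pg_points t. P \<subseteq> {x \<in> carrier_vec t. supported s 0 (x :: 'a vec)}}"
proof -
  have lt: "s * k < t" if "k < t div s" for k
    using assms that by (metis dvd_mult_div_cancel nat_mult_less_cancel_disj)
  have "{(sigma q t ^^ (s * k)) (R_point t :: 'a vec set) | k. k < t div s}
      = (\<lambda>k. pg_point t (unit_vec t (s * k))) ` {..<t div s}"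
    using sigma_pow_R_point[OF lt] by (auto simp: image_iff)
  also have "pg_span t \<dots> = {P \<in> pg_points t. P \<subseteq> {x \<in> carrier_vec t. supported s 0 (x :: 'a vec)}}"
  proof (rule pg_span_eq[OF _ _ closed_subspace_supported])
    fix U :: "'a vec set"
    assume U: "closed_subspace t U" "(\<lambda>k. unit_vec t (s * k)) ` {..<t div s} \<subseteq> U"
    show "{x \<in> carrier_vec t. supported s 0 x} \<subseteq> U"
    proof
      fix x :: "'a vec" assume x: "x \<in> {x \<in> carrier_vec t. supported s 0 x}"
      have "vec t (\<lambda>m. \<Sum>k\<in>{..<t div s}. x $ (s * k) * (if m = s * k then 1 else 0)) \<in> U"
        by (rule closed_subspace_sum[OF U(1)]) (use U(2) in \<open>auto simp: unit_vec_def\<close>)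
      also have "vec t (\<lambda>m. \<Sum>k\<in>{..<t div s}. x $ (s * k) * (if m = s * k then 1 else 0)) = x"
      proof (rule eq_vecI)
        fix m assume "m < dim_vec x"
        then have m: "m < t" using x by (auto dest: carrier_vecD)
        have "(\<Sum>k\<in>{..<t div s}. x $ (s * k) * (if m = s * k then 1 else 0)) = x $ m"
        proof (cases "s dvd m")
          case True
          have "(\<Sum>k\<in>{..<t div s}. x $ (s * k) * (if m = s * k then 1 else 0))
              = (\<Sum>k\<in>{..<t div s}. if k = m div s then x $ m else 0)"
            using True assms(2) by (intro sum.cong) auto
          moreover have "m div s < t div s"
            using m True assms by (metis dvd_mult_div_cancel nat_mult_less_cancel_disj)
          ultimately show ?thesis by simp
        next
          case False
          then have "x $ m = 0" using x m by (auto simp: supported_def dvd_eq_mod_eq_0)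
          moreover have "(\<Sum>k\<in>{..<t div s}. x $ (s * k) * (if m = s * k then 1 else 0)) = 0"
            using False by (intro sum.neutral) auto
          ultimately show ?thesis by simp
        qed
        then show "vec t (\<lambda>m. \<Sum>k\<in>{..<t div s}. x $ (s * k) * (if m = s * k then 1 else 0)) $ m = x $ m"
          using m by simp
      qed (use x in \<open>auto dest: carrier_vecD\<close>)
      finally show "x \<in> U" .
    qed
  qed (use lt in \<open>auto simp: supported_def unit_vec_def\<close>)
  finally show ?thesis .
qed

lemma Pi_space_supported:
  assumes "P \<in> Pi_space q t s" "s dvd t" "s > 0"
  obtains x :: "'a vec" where "x \<in> carrier_vec t" "x \<noteq> 0\<^sub>v t" "supported s 0 x" "P = pg_point t x"
proof -
  have P: "P \<in> pg_points t" "P \<subseteq> {x \<in> carrier_vec t. supported s 0 x}"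
    using assms unfolding Pi_space_def pg_span_R_points[OF assms(2,3)] by auto
  then obtain x where x: "x \<in> carrier_vec t" "x \<noteq> 0\<^sub>v t" "P = pg_point t x"
    unfolding pg_points_def by auto
  then have "x \<in> P" by (simp add: self_in_pg_point)
  then show ?thesis using that x P(2) by blast
qed

section \<open>Spread elements in coordinates\<close>

lemma frob_shift_ind_vec:
  assumes "s dvd t" "j < s"
  shows "frob_shift q t (ind_vec a s j) = ind_vec a s (Suc j mod s)"
proof (rule frob_shift_eqI)
  have "Suc (t - 1) = t" using t_gt by simp
  then have "(t - 1) mod s = j \<longleftrightarrow> Suc j mod s = 0"
    using Suc_mod_eq_iff[OF assms(2), of "t - 1"] assms(1) by auto
  moreover have "(a ^ (q ^ (t - 1))) ^ q = a"
    using power_q_Suc[of a "t - 1"] t_gt by simp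
  ultimately show "ind_vec a s (Suc j mod s) $ 0 = (ind_vec a s j $ (t - 1)) ^ q"
    using t_gt q_gt_1 by (auto simp: ind_vec_def)
next
  fix m assume "Suc m < t"
  then show "ind_vec a s (Suc j mod s) $ Suc m = (ind_vec a s j $ m) ^ q"
    using Suc_mod_eq_iff[OF assms(2), of m] q_gt_1 power_q_Suc[of a m] by (auto simp: ind_vec_def)
qed simp

lemma frob_shift_pow_ind_vec:
  assumes "s dvd t" "s > 0"
  shows "(frob_shift q t ^^ i) (ind_vec a s 0) = ind_vec a s (i mod s)"
proof (induction i)
  case (Suc i)
  then show ?case using frob_shift_ind_vec[OF assms(1), of "i mod s"] assms(2) by (simp add: mod_Suc_eq)
qed simp

lemma ind_vec_nonzero:
  assumes "a \<noteq> 0" "j < s" "s \<le> t"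
  shows "ind_vec a s j \<noteq> 0\<^sub>v t"
proof
  assume "ind_vec a s j = 0\<^sub>v t"
  then have "ind_vec a s j $ j = 0" using assms by simp
  then show False using assms by (simp add: ind_vec_def)
qed

lemma ind_point_in_Pi_space:
  assumes "a \<noteq> 0" "s dvd t" "s > 0"
  shows "pg_point t (ind_vec a s 0) \<in> Pi_space q t s"
proof -
  have "s \<le> t" using assms t_gt by (intro dvd_imp_le) auto
  then have pt: "pg_point t (ind_vec a s 0) \<in> pg_points t"
    using assms by (simp add: pg_points_iff ind_vec_nonzero)
  have "ind_vec a s 0 \<in> {x \<in> carrier_vec t. supported s 0 x}"
    by (simp add: ind_vec_def supported_def)
  then have "pg_point t (ind_vec a s 0) \<subseteq> {x \<in> carrier_vec t. supported s 0 x}"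
    by (simp only: pg_point_subset_iff[OF closed_subspace_supported ind_vec_carrier])
  moreover have "(sigma q t ^^ s) (pg_point t (ind_vec a s 0)) = pg_point t (ind_vec a s 0)"
    using assms by (simp add: sigma_pow_pg_point frob_shift_pow_ind_vec)
  ultimately show ?thesis
    unfolding Pi_space_def pg_span_R_points[OF assms(2,3)] Lambda_set_def using pt by blast
qed

text \<open>\<open>h\<close> is general because two instances occur: the conjugates of
  \<open>a\<close>, and coordinates pieced together from the shifts of an arbitrary
  representative.\<close>

lemma closed_subspace_graded:
  "closed_subspace t {x \<in> carrier_vec t. \<exists>g. \<forall>m<t. x $ m = g (m mod s) * (h m :: 'a)}"
  unfolding closed_subspace_def
proof (intro conjI ballI allI)
  show "0\<^sub>v t \<in> {x \<in> carrier_vec t. \<exists>g. \<forall>m<t. x $ m = g (m mod s) * h m}"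
    by (auto intro!: exI[of _ "\<lambda>_. 0"])
next
  fix x y assume "x \<in> {x \<in> carrier_vec t. \<exists>g. \<forall>m<t. x $ m = g (m mod s) * h m}"
    "y \<in> {x \<in> carrier_vec t. \<exists>g. \<forall>m<t. x $ m = g (m mod s) * h m}"
  then obtain g g' where "x \<in> carrier_vec t" "y \<in> carrier_vec t"
    "\<forall>m<t. x $ m = g (m mod s) * h m" "\<forall>m<t. y $ m = g' (m mod s) * h m" by blast
  then show "x + y \<in> {x \<in> carrier_vec t. \<exists>g. \<forall>m<t. x $ m = g (m mod s) * h m}"
    by (auto intro!: exI[of _ "\<lambda>r. g r + g' r"] simp: distrib_right)
next
  fix c x assume "x \<in> {x \<in> carrier_vec t. \<exists>g. \<forall>m<t. x $ m = g (m mod s) * h m}"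
  then obtain g where "x \<in> carrier_vec t" "\<forall>m<t. x $ m = g (m mod s) * h m" by blast
  then show "c \<cdot>\<^sub>v x \<in> {x \<in> carrier_vec t. \<exists>g. \<forall>m<t. x $ m = g (m mod s) * h m}"
    by (auto intro!: exI[of _ "\<lambda>r. c * g r"])
qed auto

lemma closed_subspace_conj_space: "closed_subspace t (conj_space a s)"
  unfolding conj_space_def by (rule closed_subspace_graded)

lemma ind_vec_in_conj_space: "ind_vec a s j \<in> conj_space a s"
  by (auto simp: conj_space_def ind_vec_def intro!: exI[of _ "\<lambda>r. if r = j then 1 else 0"])

lemma pg_span_ind_points:
  assumes "s dvd t" "s > 0"
  shows "pg_span t {(sigma q t ^^ i) (pg_point t (ind_vec a s 0)) | i. i < s}
    = {P \<in> pg_points t. P \<subseteq> conj_space a s}"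
proof -
  have "{(sigma q t ^^ i) (pg_point t (ind_vec a s 0)) | i. i < s}
      = (\<lambda>i. pg_point t (ind_vec a s i)) ` {..<s}"
    unfolding setcompr_eq_image lessThan_def[symmetric]
    using assms by (intro image_cong) (auto simp: sigma_pow_pg_point frob_shift_pow_ind_vec)
  also have "pg_span t \<dots> = {P \<in> pg_points t. P \<subseteq> conj_space a s}"
  proof (rule pg_span_eq[OF _ _ closed_subspace_conj_space])
    fix U :: "'a vec set"
    assume U: "closed_subspace t U" "ind_vec a s ` {..<s} \<subseteq> U"
    show "conj_space a s \<subseteq> U"
    proof
      fix x assume "x \<in> conj_space a s"
      then obtain g where g: "x \<in> carrier_vec t" "\<forall>m<t. x $ m = g (m mod s) * a ^ (q ^ m)"
        unfolding conj_space_def by blast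
      have "vec t (\<lambda>m. \<Sum>j\<in>{..<s}. g j * (if m mod s = j then a ^ (q ^ m) else 0)) \<in> U"
        by (rule closed_subspace_sum[OF U(1)]) (use U(2) in \<open>auto simp: ind_vec_def\<close>)
      also have "vec t (\<lambda>m. \<Sum>j\<in>{..<s}. g j * (if m mod s = j then a ^ (q ^ m) else 0)) = x"
        using g assms(2) by (intro eq_vecI) (auto simp: if_distrib[of "(*) _"] cong: if_cong)
      finally show "x \<in> U" .
    qed
  qed (auto intro: ind_vec_in_conj_space)
  finally show ?thesis .
qed

lemma spread_elem_in_spread:
  assumes "a \<noteq> 0" "s dvd t" "s > 0"
  shows "spread_elem a s \<in> spread q t s"
  unfolding spread_def spread_elem_def pg_span_ind_points[OF assms(2,3), symmetric]
  using ind_point_in_Pi_space[OF assms] by blast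

text \<open>If \<open>conj_vec a\<close> lies in the span of the shifts of \<open>x\<close>, its
  part on residue class 0 is a multiple of \<open>x\<close>. That part is
  \<open>ind_vec a s 0\<close>, so it determines the indicator point \<open>X\<close> and with it
  \<open>D\<close>.\<close>

lemma spread_elem_unique:
  assumes D: "D \<in> spread q t s" "pg_point t (conj_vec a) \<in> D" and s: "s dvd t" "s > 0" and a: "a \<noteq> 0"
  shows "D = spread_elem a s"
proof -
  obtain X where X: "X \<in> Pi_space q t s"
    "D = pg_span t {(sigma q t ^^ i) X | i. i < s} \<inter> subgeom q t"
    using D(1) unfolding spread_def by blast
  obtain x :: "'a vec" where x: "x \<in> carrier_vec t" "supported s 0 x" "X = pg_point t x"
    using Pi_space_supported[OF X(1) s] by blast
  \<comment> \<open>The first \<open>s\<close> shifts of \<open>x\<close> have disjoint supports,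
    one residue class each, so a single function records all their coordinates.\<close>
  let ?h = "\<lambda>m. (frob_shift q t ^^ (m mod s)) x $ m"
  let ?W = "{y \<in> carrier_vec t. \<exists>g. \<forall>m<t. y $ m = g (m mod s) * ?h m}"
  have "(frob_shift q t ^^ i) x \<in> ?W" if "i < s" for i
  proof -
    have "(frob_shift q t ^^ i) x $ m = (if m mod s = i then 1 else 0) * ?h m" if "m < t" for m
      using supported_frob_shift_pow[OF s(1) x(2), of i] that \<open>i < s\<close> by (auto simp: supported_def)
    then show ?thesis
      using x(1) by (intro CollectI conjI exI[of _ "\<lambda>r. if r = i then 1 else 0"]) auto
  qed
  then have "(sigma q t ^^ i) X \<subseteq> ?W" if "i < s" for i
    unfolding x(3) sigma_pow_pg_point[OF x(1)]
      pg_point_subset_iff[OF closed_subspace_graded frob_shift_pow_carrier[OF x(1)]]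
    using that by blast
  then have "\<Union> {(sigma q t ^^ i) X | i. i < s} \<subseteq> ?W" by blast
  then have "vec_span t (\<Union> {(sigma q t ^^ i) X | i. i < s}) \<subseteq> ?W"
    by (rule vec_span_minimal[OF closed_subspace_graded])
  moreover have "conj_vec a \<in> vec_span t (\<Union> {(sigma q t ^^ i) X | i. i < s})"
    using D(2) self_in_pg_point[of "conj_vec a" t] unfolding X(2) pg_span_def by auto
  ultimately obtain g where g: "\<And>m. m < t \<Longrightarrow> conj_vec a $ m = g (m mod s) * ?h m" by blast
  have g0: "g 0 \<noteq> 0" using g[of 0] t_gt a by (auto simp: conj_vec_def)
  have "ind_vec a s 0 = g 0 \<cdot>\<^sub>v x"
  proof (rule eq_vecI)
    fix m assume "m < dim_vec (g 0 \<cdot>\<^sub>v x)"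
    then have m: "m < t" using x(1) by simp
    show "ind_vec a s 0 $ m = (g 0 \<cdot>\<^sub>v x) $ m"
    proof (cases "m mod s = 0")
      case True
      then show ?thesis using g[OF m] m x(1) by (simp add: conj_vec_def ind_vec_def)
    next
      case False
      then show ?thesis using x(1,2) m by (auto simp: ind_vec_def supported_def)
    qed
  qed (use x(1) in \<open>simp add: ind_vec_def\<close>)
  then have "X = pg_point t (ind_vec a s 0)"
    using g0 x by (simp add: pg_point_smult)
  then show ?thesis
    unfolding X(2) spread_elem_def by (simp only: pg_span_ind_points[OF s])
qed

lemma conj_pt_in_spread_elem_iff:
  assumes "a \<noteq> 0" "b \<noteq> 0" "s dvd t"
  shows "pg_point t (conj_vec b) \<in> spread_elem a s \<longleftrightarrow> (a / b) ^ (q ^ s) = a / b"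
proof -
  have le: "s \<le> t" using assms t_gt by (intro dvd_imp_le) auto
  have "pg_point t (conj_vec b) \<in> spread_elem a s \<longleftrightarrow> conj_vec b \<in> conj_space a s"
    using conj_pt_subgeom[OF assms(2)] pg_point_subset_iff[OF closed_subspace_conj_space conj_vec_carrier]
    by (auto simp: spread_elem_def subgeom_def)
  also have "\<dots> \<longleftrightarrow> (a / b) ^ (q ^ s) = a / b"
  proof
    assume "conj_vec b \<in> conj_space a s"
    then obtain g where g: "\<And>m. m < t \<Longrightarrow> b ^ (q ^ m) = g (m mod s) * a ^ (q ^ m)"
      unfolding conj_space_def conj_vec_def by auto
    \<comment> \<open>Coordinates 0 and \<open>s\<close> share a residue class, hence the factor
      \<open>g 0\<close>. For \<open>s = t\<close> there is no coordinate \<open>s\<close>, but then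
      the claim is \<open>power_qt\<close>.\<close>
    show "(a / b) ^ (q ^ s) = a / b"
    proof (cases "s = t")
      case False
      have "b = g 0 * a" "b ^ (q ^ s) = g 0 * a ^ (q ^ s)"
        using g[of 0] g[of s] False le t_gt by auto
      moreover from this have "g 0 \<noteq> 0" using assms(2) by auto
      ultimately have "a / b = 1 / g 0" "a ^ (q ^ s) / b ^ (q ^ s) = 1 / g 0"
        using assms(1,2) by (auto simp del: power_mult_distrib)
      then show ?thesis unfolding power_divide by simp
    qed simp
  next
    assume eq: "(a / b) ^ (q ^ s) = a / b"
    have "(b / a) ^ (q ^ s) = inverse ((a / b) ^ (q ^ s))" by (simp flip: power_inverse)
    then have fixed: "(b / a) ^ (q ^ s) = b / a" unfolding eq by simp
    have "b ^ (q ^ m) = (b / a) ^ (q ^ (m mod s)) * a ^ (q ^ m)" for m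
      unfolding power_q_mod[OF fixed] using assms(1) by (simp add: power_divide)
    then show "conj_vec b \<in> conj_space a s"
      unfolding conj_space_def conj_vec_def
      by (intro CollectI conjI exI[of _ "\<lambda>r. (b / a) ^ (q ^ r)"]) auto
  qed
  finally show ?thesis .
qed

section \<open>Common spread elements and the minimal divisor\<close>

lemma common_spread_elem_iff:
  assumes "a \<noteq> 0" "b \<noteq> 0" "s dvd t" "s > 0"
  shows "(\<exists>D \<in> spread q t s. pg_point t (conj_vec a) \<in> D \<and> pg_point t (conj_vec b) \<in> D)
    \<longleftrightarrow> (a / b) ^ (q ^ s) = a / b"
proof
  assume "\<exists>D \<in> spread q t s. pg_point t (conj_vec a) \<in> D \<and> pg_point t (conj_vec b) \<in> D"
  then have "pg_point t (conj_vec b) \<in> spread_elem a s"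
    using spread_elem_unique[OF _ _ assms(3,4,1)] by blast
  then show "(a / b) ^ (q ^ s) = a / b" using conj_pt_in_spread_elem_iff assms by blast
next
  assume "(a / b) ^ (q ^ s) = a / b"
  then have "pg_point t (conj_vec b) \<in> spread_elem a s" "pg_point t (conj_vec a) \<in> spread_elem a s"
    using assms by (simp_all add: conj_pt_in_spread_elem_iff)
  then show "\<exists>D \<in> spread q t s. pg_point t (conj_vec a) \<in> D \<and> pg_point t (conj_vec b) \<in> D"
    using spread_elem_in_spread[OF assms(1,3,4)] by blast
qed

text \<open>If two of the first \<open>s\<close> conjugates agree, \<open>w' / w\<close> is fixed by
  the Frobenius powers with exponents \<open>j - i\<close> and \<open>t\<close>, hence by the one
  for their gcd, a divisor of \<open>t\<close> below \<open>s\<close>.\<close>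

lemma min_divisor_generating_pair:
  assumes "w \<noteq> 0" "w' \<noteq> 0" "pt w \<noteq> pt w'"
  shows "generating_pair q t w w' (min_divisor q t (pt w) (pt w'))"
proof -
  let ?e = "w' / w"
  let ?P = "\<lambda>s. s > 1 \<and> s dvd t \<and> (\<exists>D \<in> spread q t s. pt w \<in> D \<and> pt w' \<in> D)"
  have P_iff: "?P s \<longleftrightarrow> s > 1 \<and> s dvd t \<and> ?e ^ (q ^ s) = ?e" for s
    using common_spread_elem_iff[of "1 / w" "1 / w'" s] assms(1,2) by (auto simp: pt_def)
  define s where "s = min_divisor q t (pt w) (pt w')"
  have "?P t" unfolding P_iff using t_gt by simp
  then have "?P s" unfolding s_def min_divisor_def by (rule LeastI)
  then have s: "s > 1" "s dvd t" "?e ^ (q ^ s) = ?e" unfolding P_iff by auto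
  have least: "s \<le> r" if "r > 1" "r dvd t" "?e ^ (q ^ r) = ?e" for r
    unfolding s_def min_divisor_def by (rule Least_le) (use that P_iff in blast)
  have not_fixed: "?e ^ q \<noteq> ?e"
    using assms pt_eq_iff[of w' w] by metis
  have distinct: "?e ^ (q ^ i) \<noteq> ?e ^ (q ^ j)" if ij: "i < j" "j < s" for i j
  proof
    assume "?e ^ (q ^ i) = ?e ^ (q ^ j)"
    moreover have "?e ^ (q ^ j) = (?e ^ (q ^ (j - i))) ^ (q ^ i)"
      using ij(1) by (simp flip: power_mult power_add)
    ultimately have "?e ^ (q ^ (j - i)) = ?e" using power_qm_inj by metis
    then have g: "?e ^ (q ^ gcd (j - i) t) = ?e"
      by (intro power_eq_self_gcd[OF card_a power_q_inj]) auto
    have "gcd (j - i) t \<le> j - i" using ij(1) by (intro gcd_le1_nat) simp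
    then have "gcd (j - i) t < s" using ij by linarith
    \<comment> \<open>Minimality ranges only over divisors greater than 1, so the gcd 1 survives;
      \<open>not_fixed\<close> excludes it.\<close>
    then have "gcd (j - i) t \<le> 1" using least[OF _ _ g] by fastforce
    moreover have "gcd (j - i) t > 0" using t_gt by simp
    ultimately have "gcd (j - i) t = 1" by linarith
    then show False using g not_fixed by simp
  qed
  show ?thesis
  proof (unfold_locales)
    fix i j assume "i < min_divisor q t (pt w) (pt w')" "j < min_divisor q t (pt w) (pt w')" "i \<noteq> j"
    then show "?e ^ (q ^ i) \<noteq> ?e ^ (q ^ j)"
      using distinct[of i j] distinct[of j i] unfolding s_def[symmetric] by (metis nat_neq_iff)
  qed (use assms s s_def in auto)
qed

text \<open>A point of the \<open>i\<close>-th conjugate of the indicator space is supported on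
  residue class \<open>i\<close>, and the vectors of \<open>conj_space\<close> with this support are
  the multiples of a single one.\<close>

lemma indicator_points_subset:
  assumes "s dvd t" "s > 0"
  shows "indicator_points q t s (spread_elem a s) \<subseteq> (\<lambda>j. pg_point t (ind_vec a s j)) ` {..<s}"
proof
  fix Y assume "Y \<in> indicator_points q t s (spread_elem a s)"
  then obtain i where i: "i < s" "Y \<in> pg_span t (spread_elem a s)" "Y \<in> (sigma q t ^^ i) ` Pi_space q t s"
    unfolding indicator_points_def by blast
  obtain x :: "'a vec" where x: "x \<in> carrier_vec t" "supported s 0 x" "Y = pg_point t ((frob_shift q t ^^ i) x)"
    using i(3) Pi_space_supported[OF _ assms] sigma_pow_pg_point by (metis (no_types, lifting) image_iff)
  define y where "y = (frob_shift q t ^^ i) x"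
  have y: "y \<in> carrier_vec t" "supported s i y" "Y = pg_point t y"
    using x supported_frob_shift_pow[OF assms(1) x(2)] by (simp_all add: y_def)
  have "vec_span t (\<Union> (spread_elem a s)) \<subseteq> conj_space a s"
    by (rule vec_span_minimal[OF closed_subspace_conj_space]) (auto simp: spread_elem_def)
  then have "y \<in> conj_space a s"
    using i(2) self_in_pg_point[OF y(1)] y(3) unfolding pg_span_def by blast
  then obtain g where g: "\<And>m. m < t \<Longrightarrow> y $ m = g (m mod s) * a ^ (q ^ m)"
    unfolding conj_space_def by blast
  have y_eq: "y = g i \<cdot>\<^sub>v ind_vec a s i"
  proof (rule eq_vecI)
    fix m assume "m < dim_vec (g i \<cdot>\<^sub>v ind_vec a s i)"
    then have m: "m < t" by (simp add: ind_vec_def)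
    show "y $ m = (g i \<cdot>\<^sub>v ind_vec a s i) $ m"
      using g[OF m] y(2) m i(1) by (auto simp: supported_def ind_vec_def)
  qed (use y(1) in \<open>simp add: ind_vec_def\<close>)
  have "Y \<in> pg_points t" using i(2) by (simp add: pg_span_def)
  then have "y \<noteq> 0\<^sub>v t" using pg_points_iff[OF y(1)] y(3) by simp
  moreover have "y = 0\<^sub>v t" if "g i = 0"
    unfolding y_eq that by (intro eq_vecI) (auto simp: ind_vec_def)
  ultimately have "g i \<noteq> 0" by blast
  then have "Y = pg_point t (ind_vec a s i)" using y(3) y_eq by (simp add: pg_point_smult)
  then show "Y \<in> (\<lambda>j. pg_point t (ind_vec a s j)) ` {..<s}" using i(1) by blast
qed

end

context generating_pair
begin

text \<open>Interpolation: a combination of the vectors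
  \<open>conj_vec (1 / w * (w' / w) ^ n)\<close> with the coefficients of a polynomial
  \<open>p\<close> has coordinates \<open>(1 / w) ^ (q ^ m)\<close> times \<open>p\<close> at the
  conjugates of \<open>w' / w\<close>. Choosing \<open>p\<close> to vanish at all of these but
  number \<open>j\<close> isolates one residue class.\<close>

lemma conj_sum_ind_vec:
  assumes j: "j < s"
  obtains d l \<kappa> where "\<kappa> \<noteq> 0"
    "vec t (\<lambda>m. \<Sum>n\<in>{..d}. l n * (1 / w * (w' / w) ^ n) ^ (q ^ m)) = \<kappa> \<cdot>\<^sub>v ind_vec (1 / w) s j"
proof -
  define e where "e = w' / w"
  define p where "p = (\<Prod>i\<in>{..<s} - {j}. [:- (e ^ (q ^ i)), 1:])"
  have poly_p: "poly p x = (\<Prod>i\<in>{..<s} - {j}. x - e ^ (q ^ i))" for x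
    unfolding p_def by (simp add: poly_prod)
  have conj_term: "(1 / w * e ^ n) ^ (q ^ m) = (1 / w) ^ (q ^ m) * (e ^ (q ^ m)) ^ n" for n m
    by (metis power_mult_distrib power_mult mult.commute)
  have "(\<Sum>n\<le>degree p. Polynomial.coeff p n * (1 / w * e ^ n) ^ (q ^ m))
      = (1 / w) ^ (q ^ m) * poly p (e ^ (q ^ (m mod s)))" for m
    unfolding power_q_mod[OF ratio_fixed, folded e_def] poly_altdef sum_distrib_left conj_term
    by (intro sum.cong refl mult.left_commute)
  moreover have "poly p (e ^ (q ^ i)) = 0" if "i < s" "i \<noteq> j" for i
    unfolding poly_p using that by (intro prod_zero) (auto intro!: bexI[of _ i])
  moreover have "m mod s < s" for m using s_gt by simp
  ultimately have "vec t (\<lambda>m. \<Sum>n\<in>{..degree p}. Polynomial.coeff p n * (1 / w * e ^ n) ^ (q ^ m))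
      = poly p (e ^ (q ^ j)) \<cdot>\<^sub>v ind_vec (1 / w) s j"
    unfolding ind_vec_def by (intro eq_vecI) auto
  moreover have "poly p (e ^ (q ^ j)) \<noteq> 0"
    unfolding poly_p using ratio_distinct[of j] j by (auto simp: e_def)
  ultimately show ?thesis using that unfolding e_def by blast
qed

text \<open>The extension is spanned by subgeometry points of the spread element. Those belonging to
  \<open>1 / w * (w' / w) ^ n\<close> lie in it, and by interpolation they already generate the
  indicator vectors.\<close>

lemma ind_point_in_indicator_points:
  assumes j: "j < s"
  shows "pg_point t (ind_vec (1 / w) s j) \<in> indicator_points q t s (spread_elem (1 / w) s)"
proof -
  let ?a = "1 / w" and ?e = "w' / w"
  let ?S = "vec_span t (\<Union> (spread_elem ?a s))"
  have a0: "?a \<noteq> 0" and e0: "?e \<noteq> 0" using w0 w'0 by simp_all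
  have s0: "s > 0" using s_gt by simp
  have car: "\<Union> (spread_elem ?a s) \<subseteq> carrier_vec t"
    unfolding spread_elem_def conj_space_def by blast
  have "conj_vec (?a * ?e ^ n) \<in> ?S" for n
  proof -
    have "(?a / (?a * ?e ^ n)) ^ (q ^ s) = ?a / (?a * ?e ^ n)"
    proof -
      have "?a / (?a * ?e ^ n) = inverse (?e ^ n)" using a0 by (simp add: divide_inverse)
      moreover have "inverse (?e ^ n) ^ (q ^ s) = inverse ((?e ^ (q ^ s)) ^ n)"
        by (simp add: power_inverse mult.commute flip: power_mult)
      ultimately show ?thesis unfolding ratio_fixed by simp
    qed
    then have "pg_point t (conj_vec (?a * ?e ^ n)) \<in> spread_elem ?a s"
      by (subst conj_pt_in_spread_elem_iff) (use a0 e0 s_dvd in auto)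
    then show ?thesis
      using vec_span_superset[OF car] self_in_pg_point[OF conj_vec_carrier] by blast
  qed
  then have mem: "vec t (\<lambda>m. (?a * ?e ^ n) ^ (q ^ m)) \<in> ?S" for n unfolding conj_vec_def .
  obtain d l \<kappa> where k: "\<kappa> \<noteq> 0"
    "vec t (\<lambda>m. \<Sum>n\<in>{..d}. l n * (?a * ?e ^ n) ^ (q ^ m)) = \<kappa> \<cdot>\<^sub>v ind_vec ?a s j"
    using conj_sum_ind_vec[OF j] by blast
  have S: "closed_subspace t ?S" by (rule closed_subspace_vec_span[OF car])
  have "\<kappa> \<cdot>\<^sub>v ind_vec ?a s j \<in> ?S"
    unfolding k(2)[symmetric] by (rule closed_subspace_sum[OF S]) (use mem in auto)
  then have "(1 / \<kappa>) \<cdot>\<^sub>v (\<kappa> \<cdot>\<^sub>v ind_vec ?a s j) \<in> ?S" using S unfolding closed_subspace_def by blast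
  then have "ind_vec ?a s j \<in> ?S" using k(1) by (simp add: smult_smult_assoc)
  then have "pg_point t (ind_vec ?a s j) \<in> pg_span t (spread_elem ?a s)"
    unfolding pg_span_def using pg_point_subset_iff[OF S ind_vec_carrier] pg_points_iff[OF ind_vec_carrier]
      ind_vec_nonzero[OF a0 j s_le] by blast
  moreover have "pg_point t (ind_vec ?a s j) = (sigma q t ^^ j) (pg_point t (ind_vec ?a s 0))"
    using j s_dvd s0 by (simp add: sigma_pow_pg_point frob_shift_pow_ind_vec)
  ultimately show ?thesis
    unfolding indicator_points_def using j ind_point_in_Pi_space[OF a0 s_dvd s0] by blast
qed

end

context big_field
begin

text \<open>One direction shows that every admissible curve gives this block, the other that an
  admissible curve exists.\<close>

lemma is_block_through_iff:
  assumes "w \<noteq> 0" "w' \<noteq> 0" "pt w \<noteq> pt w'"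
  shows "is_block_through q t (pt w) (pt w') B \<longleftrightarrow> B = block w w'"
proof -
  define s where "s = min_divisor q t (pt w) (pt w')"
  interpret G: generating_pair q t ty w w' s
    unfolding s_def by (rule min_divisor_generating_pair[OF assms])
  have s0: "s > 0" using G.s_gt by simp
  have a0: "1 / w \<noteq> 0" "1 / w' \<noteq> 0" using assms by simp_all
  have "(1 / w / (1 / w')) ^ (q ^ s) = 1 / w / (1 / w')" using G.ratio_fixed by simp
  then have in_D: "pt w \<in> spread_elem (1 / w) s" "pt w' \<in> spread_elem (1 / w) s"
    unfolding pt_def using a0 G.s_dvd by (simp_all add: conj_pt_in_spread_elem_iff)
  show ?thesis
  proof
    assume "is_block_through q t (pt w) (pt w') B"
    then obtain D C where D: "D \<in> spread q t s" "pt w \<in> D"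
      and C: "normal_rational_curve t (s - 1) C" "pt w \<in> C" "pt w' \<in> C"
        "indicator_points q t s D \<subseteq> C" "B = C \<inter> subgeom q t"
      unfolding is_block_through_def Let_def s_def[symmetric] by blast
    have "D = spread_elem (1 / w) s"
      by (rule spread_elem_unique[OF D(1) _ G.s_dvd s0 a0(1)]) (use D(2) in \<open>simp add: pt_def\<close>)
    then show "B = block w w'"
      using G.curve_subgeom[OF C(1-3)] G.ind_point_in_indicator_points C(4,5) by blast
  next
    assume B: "B = block w w'"
    obtain C where C: "normal_rational_curve t (s - 1) C" "pt w \<in> C" "pt w' \<in> C"
      "\<And>j. j < s \<Longrightarrow> pg_point t (ind_vec (1 / w) s j) \<in> C"
      using G.curve_exists by blast
    have "indicator_points q t s (spread_elem (1 / w) s) \<subseteq> C"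
      using indicator_points_subset[OF G.s_dvd s0] C(4) by blast
    moreover have "B = C \<inter> subgeom q t" using B G.curve_subgeom[OF C] by blast
    ultimately show "is_block_through q t (pt w) (pt w') B"
      unfolding is_block_through_def Let_def s_def[symmetric]
      using in_D spread_elem_in_spread[OF a0(1) G.s_dvd s0] C by blast
  qed
qed

lemma H_blocks_eq:
  "H_blocks q t = {block w w' | w w'. w \<noteq> 0 \<and> w' \<noteq> 0 \<and> pt w \<noteq> pt w'}"
proof (intro equalityI subsetI)
  fix B :: "'a vec set set" assume "B \<in> H_blocks q t"
  then obtain w w' where "w \<noteq> 0" "w' \<noteq> 0" "pt w \<noteq> pt w'" "is_block_through q t (pt w) (pt w') B"
    unfolding H_blocks_def subgeom_eq by blast
  then show "B \<in> {block w w' | w w'. w \<noteq> 0 \<and> w' \<noteq> 0 \<and> pt w \<noteq> pt w'}"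
    using is_block_through_iff by blast
next
  fix B assume "B \<in> {block w w' | w w'. w \<noteq> 0 \<and> w' \<noteq> 0 \<and> pt w \<noteq> pt w'}"
  then obtain w w' where ww: "B = block w w'" "w \<noteq> 0" "w' \<noteq> 0" "pt w \<noteq> pt w'" by blast
  then have "is_block_through q t (pt w) (pt w') B" using is_block_through_iff by blast
  then show "B \<in> H_blocks q t"
    unfolding H_blocks_def using pt_in_subgeom[OF ww(2)] pt_in_subgeom[OF ww(3)] ww(4) by blast
qed

end


section \<open>The design\<close>

context big_field
begin

section \<open>The subfield with q elements and its two-dimensional spans\<close>

definition Fq :: "'a set" where
  "Fq = {x. x ^ q = x}"

lemma card_Fq: "card Fq = q"
  unfolding Fq_def using card_frob_fixed[OF card_a q_gt_1] t_gt by simp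

lemma Fq_closed:
  assumes "x \<in> Fq" "y \<in> Fq"
  shows "x + y \<in> Fq" "x - y \<in> Fq" "x * y \<in> Fq" "x / y \<in> Fq"
  using assms power_add_q[of x y 1] power_diff_q[of x y 1]
  by (auto simp: Fq_def power_mult_distrib power_divide)

lemma zero_one_in_Fq: "0 \<in> Fq" "1 \<in> Fq"
  using q_gt_1 by (auto simp: Fq_def)

lemma pt_eq_iff_Fq:
  assumes "v \<noteq> 0" "w \<noteq> 0"
  shows "pt v = pt w \<longleftrightarrow> (\<exists>c\<in>Fq. v = c * w)"
proof
  assume "pt v = pt w"
  then show "\<exists>c\<in>Fq. v = c * w"
    using pt_eq_iff[OF assms] assms by (intro bexI[of _ "v / w"]) (auto simp: Fq_def)
next
  assume "\<exists>c\<in>Fq. v = c * w"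
  then show "pt v = pt w" using pt_eq_iff[OF assms] assms by (auto simp: Fq_def)
qed

definition Fq_span :: "'a \<Rightarrow> 'a \<Rightarrow> 'a set" where
  "Fq_span w w' = {A * w + B * w' | A B. A \<in> Fq \<and> B \<in> Fq}"

lemma Fq_comb_eq_0_iff:
  assumes "w \<noteq> 0" "w' \<noteq> 0" "pt w \<noteq> pt w'" "A \<in> Fq" "B \<in> Fq"
  shows "A * w + B * w' = 0 \<longleftrightarrow> A = 0 \<and> B = 0"
proof
  assume eq: "A * w + B * w' = 0"
  have "A = 0"
  proof (rule ccontr)
    assume "A \<noteq> 0"
    have "A * w = (0 - B) * w'" using eq by (simp add: eq_neg_iff_add_eq_0)
    then have "A * w / A = (0 - B) / A * w'" by simp
    then have "w = (0 - B) / A * w'" using \<open>A \<noteq> 0\<close> by simp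
    moreover have "(0 - B) / A \<in> Fq" by (intro Fq_closed zero_one_in_Fq assms)
    ultimately have "pt w = pt w'" unfolding pt_eq_iff_Fq[OF assms(1,2)] by blast
    then show False using assms(3) by blast
  qed
  then show "A = 0 \<and> B = 0" using eq assms(2) by simp
qed simp

lemma card_Fq_span:
  assumes "w \<noteq> 0" "w' \<noteq> 0" "pt w \<noteq> pt w'"
  shows "card (Fq_span w w') = q ^ 2"
proof -
  have "inj_on (\<lambda>(A, B). A * w + B * w') (Fq \<times> Fq)"
  proof (rule inj_onI, clarify)
    fix A B C D assume F: "A \<in> Fq" "B \<in> Fq" "C \<in> Fq" "D \<in> Fq"
      and eq: "A * w + B * w' = C * w + D * w'"
    have "(A - C) * w + (B - D) * w' = 0" using eq by (simp add: algebra_simps)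
    then show "A = C \<and> B = D"
      using Fq_comb_eq_0_iff[OF assms Fq_closed(2)[OF F(1,3)] Fq_closed(2)[OF F(2,4)]] by simp
  qed
  then have "card ((\<lambda>(A, B). A * w + B * w') ` (Fq \<times> Fq)) = q ^ 2"
    by (simp add: card_image card_cartesian_product card_Fq power2_eq_square)
  moreover have "(\<lambda>(A, B). A * w + B * w') ` (Fq \<times> Fq) = Fq_span w w'"
    unfolding Fq_span_def by auto
  ultimately show ?thesis by simp
qed

lemma Fq_span_closed:
  assumes "u \<in> Fq_span w w'" "v \<in> Fq_span w w'" "A \<in> Fq" "B \<in> Fq"
  shows "A * u + B * v \<in> Fq_span w w'"
proof -
  obtain a b where u: "u = a * w + b * w'" "a \<in> Fq" "b \<in> Fq" using assms(1) by (auto simp: Fq_span_def)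
  obtain c d where v: "v = c * w + d * w'" "c \<in> Fq" "d \<in> Fq" using assms(2) by (auto simp: Fq_span_def)
  have "A * u + B * v = (A * a + B * c) * w + (A * b + B * d) * w'"
    unfolding u(1) v(1) by (simp add: algebra_simps)
  moreover have "A * a + B * c \<in> Fq" "A * b + B * d \<in> Fq"
    using assms(3,4) u v by (simp_all add: Fq_closed)
  ultimately show ?thesis unfolding Fq_span_def by blast
qed

lemma Fq_span_subset:
  assumes "u \<in> Fq_span w w'" "v \<in> Fq_span w w'"
  shows "Fq_span u v \<subseteq> Fq_span w w'"
  using Fq_span_closed[OF assms] by (auto simp: Fq_span_def[of u v])

lemma in_Fq_span: "w \<in> Fq_span w w'" "w' \<in> Fq_span w w'"
proof -
  have "w = 1 * w + 0 * w'" "w' = 0 * w + 1 * w'" by simp_all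
  then show "w \<in> Fq_span w w'" "w' \<in> Fq_span w w'"
    unfolding Fq_span_def using zero_one_in_Fq by blast+
qed

lemma block_eq_image:
  assumes "w \<noteq> 0" "w' \<noteq> 0" "pt w \<noteq> pt w'"
  shows "block w w' = pt ` (Fq_span w w' - {0})"
proof -
  have "A ^ q = A \<and> B ^ q = B \<and> (A, B) \<noteq> (0, 0) \<longleftrightarrow> A \<in> Fq \<and> B \<in> Fq \<and> A * w + B * w' \<noteq> 0"
    for A B
    using Fq_comb_eq_0_iff[OF assms, of A B] by (auto simp: Fq_def)
  then have block: "block w w' = {pt (A * w + B * w') | A B. A \<in> Fq \<and> B \<in> Fq \<and> A * w + B * w' \<noteq> 0}"
    unfolding block_def by simp
  show ?thesis
  proof (intro equalityI subsetI)
    fix P assume "P \<in> block w w'"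
    then obtain A B where AB: "P = pt (A * w + B * w')" "A \<in> Fq" "B \<in> Fq" "A * w + B * w' \<noteq> 0"
      unfolding block by blast
    then have "A * w + B * w' \<in> Fq_span w w' - {0}" unfolding Fq_span_def by blast
    then show "P \<in> pt ` (Fq_span w w' - {0})" using AB(1) by (rule image_eqI[rotated])
  next
    fix P assume "P \<in> pt ` (Fq_span w w' - {0})"
    then obtain x where x: "P = pt x" "x \<in> Fq_span w w'" "x \<noteq> 0" by blast
    then obtain A B where "x = A * w + B * w'" "A \<in> Fq" "B \<in> Fq" unfolding Fq_span_def by blast
    then show "P \<in> block w w'" unfolding block using x(1,3) by blast
  qed
qed

lemma pt_in_block_iff:
  assumes "w \<noteq> 0" "w' \<noteq> 0" "pt w \<noteq> pt w'" "u \<noteq> 0"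
  shows "pt u \<in> block w w' \<longleftrightarrow> u \<in> Fq_span w w'"
proof
  assume "pt u \<in> block w w'"
  then obtain v where v: "v \<in> Fq_span w w'" "v \<noteq> 0" "pt u = pt v"
    unfolding block_eq_image[OF assms(1-3)] by auto
  then obtain c where "c \<in> Fq" "u = c * v" using pt_eq_iff_Fq[OF assms(4)] by blast
  then show "u \<in> Fq_span w w'"
    using Fq_span_closed[OF v(1) v(1), of c 0] zero_one_in_Fq by simp
qed (use assms block_eq_image in auto)

text \<open>The span of \<open>u\<close> and \<open>v\<close> lies in that of \<open>w\<close> and
  \<open>w'\<close>, and both have \<open>q ^ 2\<close> elements.\<close>

lemma block_unique:
  assumes "w \<noteq> 0" "w' \<noteq> 0" "pt w \<noteq> pt w'" "u \<noteq> 0" "v \<noteq> 0" "pt u \<noteq> pt v"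
    and "pt u \<in> block w w'" "pt v \<in> block w w'"
  shows "block w w' = block u v"
proof -
  have "u \<in> Fq_span w w'" "v \<in> Fq_span w w'"
    using assms(7,8) pt_in_block_iff[OF assms(1-3)] assms(4,5) by auto
  then have "Fq_span u v \<subseteq> Fq_span w w'" by (rule Fq_span_subset)
  moreover have "card (Fq_span u v) = card (Fq_span w w')"
    using card_Fq_span[OF assms(1-3)] card_Fq_span[OF assms(4-6)] by simp
  ultimately have "Fq_span u v = Fq_span w w'" by (intro card_subset_eq) auto
  then show ?thesis using block_eq_image[OF assms(1-3)] block_eq_image[OF assms(4-6)] by simp
qed

text \<open>Each fibre of \<open>pt\<close> is an orbit of the nonzero elements of
  \<open>Fq\<close>. \<open>S\<close> is general so that the same count serves for all points and
  for a single block.\<close>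

lemma card_pt_image:
  assumes "0 \<notin> S" "\<And>c v. c \<in> Fq \<Longrightarrow> c \<noteq> 0 \<Longrightarrow> v \<in> S \<Longrightarrow> c * v \<in> S"
  shows "card (pt ` S) * (q - 1) = card S"
proof -
  have "card S = (\<Sum>v\<in>S. 1)" by simp
  also have "\<dots> = (\<Sum>P\<in>pt ` S. \<Sum>v\<in>{v \<in> S. pt v = P}. 1)" by (rule sum.image_gen) simp
  also have "\<dots> = (\<Sum>P\<in>pt ` S. q - 1)"
  proof (intro sum.cong refl)
    fix P assume "P \<in> pt ` S"
    then obtain w where w: "w \<in> S" "P = pt w" by blast
    then have w0: "w \<noteq> 0" using assms(1) by auto
    have "{v \<in> S. pt v = P} = (\<lambda>c. c * w) ` (Fq - {0})"
    proof (intro equalityI subsetI)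
      fix v assume v: "v \<in> {v \<in> S. pt v = P}"
      then have "v \<noteq> 0" using assms(1) by auto
      then obtain c where "c \<in> Fq" "v = c * w" using v w(2) pt_eq_iff_Fq[OF _ w0] by auto
      then show "v \<in> (\<lambda>c. c * w) ` (Fq - {0})" using \<open>v \<noteq> 0\<close> by auto
    next
      fix v assume "v \<in> (\<lambda>c. c * w) ` (Fq - {0})"
      then obtain c where c: "c \<in> Fq" "c \<noteq> 0" "v = c * w" by auto
      then have "v \<noteq> 0" using w0 by simp
      then have "pt v = pt w" using c pt_eq_iff_Fq[OF _ w0] by blast
      then show "v \<in> {v \<in> S. pt v = P}" using assms(2)[OF c(1,2) w(1)] c(3) w(2) by simp
    qed
    moreover have "inj_on (\<lambda>c. c * w) (Fq - {0})" using w0 by (auto intro: inj_onI)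
    moreover have "card (Fq - {0}) = q - 1" using zero_one_in_Fq card_Fq by simp
    ultimately show "(\<Sum>v\<in>{v \<in> S. pt v = P}. 1) = q - 1" by (simp add: card_image)
  qed
  finally show ?thesis by simp
qed

lemma card_subgeom: "card (subgeom q t :: 'a vec set set) = (q ^ t - 1) div (q - 1)"
proof -
  have "card (pt ` (UNIV - {0})) * (q - 1) = card (UNIV - {0 :: 'a})"
    by (rule card_pt_image) auto
  then have "card (subgeom q t :: 'a vec set set) * (q - 1) = q ^ t - 1"
    unfolding subgeom_eq using card_a by simp
  then show ?thesis using q_gt_1 by (metis div_mult_self_is_m zero_less_diff)
qed

lemma card_block:
  assumes "w \<noteq> 0" "w' \<noteq> 0" "pt w \<noteq> pt w'"
  shows "card (block w w') = q + 1"
proof -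
  have "card (pt ` (Fq_span w w' - {0})) * (q - 1) = card (Fq_span w w' - {0})"
  proof (rule card_pt_image)
    fix c v assume "c \<in> Fq" "c \<noteq> 0" "v \<in> Fq_span w w' - {0}"
    then show "c * v \<in> Fq_span w w' - {0}"
      using Fq_span_closed[of v w w' v c 0] zero_one_in_Fq by auto
  qed simp
  moreover have "0 \<in> Fq_span w w'"
    using Fq_span_closed[OF in_Fq_span zero_one_in_Fq(1) zero_one_in_Fq(1)] by simp
  ultimately have "card (block w w') * (q - 1) = q ^ 2 - 1"
    using block_eq_image[OF assms] card_Fq_span[OF assms] by simp
  also have "\<dots> = (q + 1) * (q - 1)"
    by (simp add: power2_eq_square algebra_simps diff_mult_distrib2)
  finally have "card (block w w') * (q - 1) = (q + 1) * (q - 1)" .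
  moreover have "q - 1 \<noteq> 0" using q_gt_1 by simp
  ultimately show ?thesis using mult_right_cancel by blast
qed

lemma block_subset_subgeom:
  assumes "w \<noteq> 0" "w' \<noteq> 0" "pt w \<noteq> pt w'"
  shows "block w w' \<subseteq> subgeom q t"
  unfolding block_eq_image[OF assms] subgeom_eq by blast

lemma is_2_design_H:
  "is_2_design ((q ^ t - 1) div (q - 1)) (q + 1) 1 (subgeom q t :: 'a vec set set) (H_blocks q t)"
  unfolding is_2_design_def
proof (intro conjI ballI impI)
  show "finite (subgeom q t :: 'a vec set set)" unfolding subgeom_eq by simp
  show "card (subgeom q t :: 'a vec set set) = (q ^ t - 1) div (q - 1)" by (rule card_subgeom)
next
  fix B :: "'a vec set set" assume "B \<in> H_blocks q t"
  then show "B \<subseteq> subgeom q t" "card B = q + 1"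
    unfolding H_blocks_eq using card_block block_subset_subgeom by blast+
next
  fix P Q :: "'a vec set" assume PQ: "P \<in> subgeom q t" "Q \<in> subgeom q t" "P \<noteq> Q"
  then obtain u v where uv: "u \<noteq> 0" "v \<noteq> 0" "P = pt u" "Q = pt v" unfolding subgeom_eq by auto
  have "{B \<in> H_blocks q t. P \<in> B \<and> Q \<in> B} = {block u v}"
  proof (intro equalityI subsetI)
    fix B assume "B \<in> {B \<in> H_blocks q t. P \<in> B \<and> Q \<in> B}"
    then show "B \<in> {block u v}" unfolding H_blocks_eq using block_unique uv PQ(3) by blast
  next
    fix B assume "B \<in> {block u v}"
    moreover have ne: "pt u \<noteq> pt v" using uv PQ(3) by simp
    then have "block u v \<in> H_blocks q t" unfolding H_blocks_eq using uv(1,2) by blast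
    moreover have "P \<in> block u v" "Q \<in> block u v"
      using pt_in_block_iff[OF uv(1,2) ne] uv in_Fq_span by simp_all
    ultimately show "B \<in> {B \<in> H_blocks q t. P \<in> B \<and> Q \<in> B}" by simp
  qed
  then show "card {B \<in> H_blocks q t. P \<in> B \<and> Q \<in> B} = 1" by simp
qed

section \<open>Coordinates over the small field and the isomorphism\<close>

lemma power_sum_q: "(\<Sum>i\<in>I. f i :: 'a) ^ (q ^ m) = (\<Sum>i\<in>I. f i ^ (q ^ m))"
  by (induction I rule: infinite_finite_induct) (use q_gt_1 in \<open>auto simp: power_add_q power_0_left\<close>)

text \<open>A relation is a polynomial over \<open>Fq\<close> of degree below \<open>t\<close>;
  together with \<open>g\<close> it has all conjugates of \<open>g\<close> as roots, and there are
  \<open>t\<close> of them.\<close>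

lemma primitive_powers_independent:
  assumes g: "primitive_elem g" and z: "\<And>i. i < t \<Longrightarrow> z i \<in> Fq" and sum: "(\<Sum>i<t. z i * g ^ i) = 0"
    and "i < t"
  shows "z i = 0"
proof -
  define p where "p = (\<Sum>i<t. Polynomial.monom (z i) i)"
  have coeff_p: "Polynomial.coeff p k = (if k < t then z k else 0)" for k
    unfolding p_def by (simp add: coeff_sum coeff_monom)
  have root: "poly p (g ^ (q ^ j)) = 0" for j
  proof -
    have "poly p (g ^ (q ^ j)) = (\<Sum>i<t. (z i * g ^ i) ^ (q ^ j))"
      unfolding p_def poly_sum poly_monom
    proof (intro sum.cong refl)
      fix i assume "i \<in> {..<t}"
      then have "z i ^ (q ^ j) = z i" using power_q_fixed[of "z i" 1 j] z[of i] by (simp add: Fq_def)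
      then show "z i * (g ^ (q ^ j)) ^ i = (z i * g ^ i) ^ (q ^ j)"
        by (simp add: power_mult_distrib mult.commute flip: power_mult)
    qed
    also have "\<dots> = 0" unfolding power_sum_q[symmetric] sum using q_gt_1 by (simp add: power_0_left)
    finally show ?thesis .
  qed
  have g0: "g \<noteq> 0" using g by (simp add: primitive_elem_def)
  \<comment> \<open>Two equal conjugates would yield a positive exponent below the order
    \<open>q ^ t - 1\<close> at which \<open>g\<close> has power 1.\<close>
  have le: "i = j" if "i \<le> j" "j < t" "g ^ (q ^ i) = g ^ (q ^ j)" for i j
  proof -
    have qij: "q ^ i \<le> q ^ j" "q ^ j < q ^ t" using that q_gt_1 by (auto intro: power_increasing)
    then have "g ^ (q ^ i) * g ^ (q ^ j - q ^ i) = g ^ (q ^ j)" by (simp flip: power_add)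
    then have "g ^ (q ^ j - q ^ i) = 1" using that(3) g0 by simp
    then have "q ^ t - 1 dvd q ^ j - q ^ i" using primitive_elem_power_eq_1_iff[OF g] card_a by simp
    moreover have "q ^ j - q ^ i < q ^ t - 1"
    proof -
      have "q ^ i \<ge> 1" using q_gt_1 by simp
      then show ?thesis using qij by linarith
    qed
    ultimately have "q ^ j - q ^ i = 0" by (meson dvd_imp_le leD neq0_conv)
    then have "q ^ i = q ^ j" using qij by simp
    then show ?thesis using q_gt_1 by simp
  qed
  have inj: "inj_on (\<lambda>j. g ^ (q ^ j)) {..<t}"
  proof (rule inj_onI)
    fix i j assume "i \<in> {..<t}" "j \<in> {..<t}" "g ^ (q ^ i) = g ^ (q ^ j)"
    then show "i = j" using le[of i j] le[of j i] by (cases "i \<le> j") auto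
  qed
  have "p = 0"
  proof (rule ccontr)
    assume p0: "p \<noteq> 0"
    have "t = card ((\<lambda>j. g ^ (q ^ j)) ` {..<t})" using card_image[OF inj] by simp
    also have "\<dots> \<le> card {x. poly p x = 0}" using root by (intro card_mono) auto
    also have "\<dots> \<le> degree p" by (rule card_poly_roots_bound[OF p0])
    also have "\<dots> \<le> t - 1" by (rule degree_le) (auto simp: coeff_p)
    finally show False using t_gt by simp
  qed
  then show ?thesis using coeff_p[of i] \<open>i < t\<close> by simp
qed

text \<open>The powers \<open>g ^ i\<close> with \<open>i < t\<close> form a basis: independence
  makes \<open>\<psi>\<close> injective and counting makes it onto. Its inverse
  \<open>\<theta>\<close> takes coordinates.\<close>

lemma ex_linear_bijection:
  fixes \<phi> :: "'b::{field,finite} \<Rightarrow> 'a"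
  assumes card_b: "card (UNIV :: 'b set) = q"
    and add: "\<And>x y. \<phi> (x + y) = \<phi> x + \<phi> y" and mult: "\<And>x y. \<phi> (x * y) = \<phi> x * \<phi> y"
    and inj: "inj \<phi>" and range: "range \<phi> = Fq"
  shows "\<exists>\<theta> :: 'a \<Rightarrow> 'b vec. bij_betw \<theta> UNIV (carrier_vec t) \<and>
    (\<forall>x y. \<theta> (x + y) = \<theta> x + \<theta> y) \<and> (\<forall>c x. \<theta> (\<phi> c * x) = c \<cdot>\<^sub>v \<theta> x)"
proof -
  obtain g :: 'a where g: "primitive_elem g" using ex_primitive_elem by blast
  define \<psi> :: "'b vec \<Rightarrow> 'a" where "\<psi> x = (\<Sum>i<t. \<phi> (x $ i) * g ^ i)" for x
  let ?K = "carrier_vec t :: 'b vec set"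
  have psi_add: "\<psi> (x + y) = \<psi> x + \<psi> y" if "x \<in> ?K" "y \<in> ?K" for x y
    using that unfolding \<psi>_def by (simp add: add distrib_right sum.distrib)
  have psi_smult: "\<psi> (c \<cdot>\<^sub>v x) = \<phi> c * \<psi> x" if "x \<in> ?K" for c x
    using that unfolding \<psi>_def by (simp add: mult sum_distrib_left mult.assoc)
  have inj_psi: "inj_on \<psi> ?K"
  proof (rule inj_onI)
    fix x y assume xy: "x \<in> ?K" "y \<in> ?K" "\<psi> x = \<psi> y"
    have "(\<Sum>i<t. (\<phi> (x $ i) - \<phi> (y $ i)) * g ^ i) = 0"
      using xy(3) unfolding \<psi>_def by (simp add: left_diff_distrib sum_subtractf)
    moreover have "\<phi> (x $ i) - \<phi> (y $ i) \<in> Fq" for i using range Fq_closed(2) by blast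
    ultimately have "\<phi> (x $ i) - \<phi> (y $ i) = 0" if "i < t" for i
      using primitive_powers_independent[OF g, of "\<lambda>i. \<phi> (x $ i) - \<phi> (y $ i)" i] that by blast
    then have "x $ i = y $ i" if "i < t" for i using injD[OF inj] that by fastforce
    then show "x = y" using xy(1,2) by (intro eq_vecI) auto
  qed
  have "card (\<psi> ` ?K) = card (UNIV :: 'a set)"
    using card_image[OF inj_psi] card_carrier_vec[where ?'a = 'b, of t] card_b card_a by simp
  then have "\<psi> ` ?K = UNIV" by (intro card_subset_eq) auto
  then have bij: "bij_betw \<psi> ?K UNIV" using inj_psi by (simp add: bij_betw_def)
  define \<theta> where "\<theta> = inv_into ?K \<psi>"
  have bij_theta: "bij_betw \<theta> UNIV ?K" unfolding \<theta>_def by (rule bij_betw_inv_into[OF bij])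
  have psi_theta: "\<psi> (\<theta> x) = x" for x
    unfolding \<theta>_def using bij by (simp add: bij_betw_inv_into_right)
  have theta_psi: "\<theta> (\<psi> y) = y" if "y \<in> ?K" for y
    unfolding \<theta>_def using that inj_psi by simp
  have theta_K: "\<theta> x \<in> ?K" for x using bij_theta by (auto simp: bij_betw_def)
  have "\<theta> (x + y) = \<theta> x + \<theta> y" for x y
    using theta_psi[of "\<theta> x + \<theta> y"] psi_add[OF theta_K theta_K] theta_K by (simp add: psi_theta)
  moreover have "\<theta> (\<phi> c * x) = c \<cdot>\<^sub>v \<theta> x" for c x
    using theta_psi[of "c \<cdot>\<^sub>v \<theta> x"] psi_smult[OF theta_K] theta_K by (simp add: psi_theta)
  ultimately show ?thesis using bij_theta by blast
qed

text \<open>Since \<open>\<theta>\<close> carries proportionality and spans over \<open>Fq\<close>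
  to those over the small field, it induces the map on points and takes blocks to lines; every line
  arises because \<open>\<theta>\<close> is onto.\<close>

lemma design_iso_H:
  fixes \<phi> :: "'b::{field,finite} \<Rightarrow> 'a" and \<theta> :: "'a \<Rightarrow> 'b vec"
  assumes range: "range \<phi> = Fq" and phi0: "\<And>c. \<phi> c = 0 \<longleftrightarrow> c = 0"
    and bij: "bij_betw \<theta> UNIV (carrier_vec t)"
    and add: "\<And>x y. \<theta> (x + y) = \<theta> x + \<theta> y" and scale: "\<And>c x. \<theta> (\<phi> c * x) = c \<cdot>\<^sub>v \<theta> x"
  shows "design_iso (subgeom q t :: 'a vec set set) (H_blocks q t)
    (pg_points t :: 'b vec set set) (pg_lines t)"
proof -
  have K: "\<theta> x \<in> carrier_vec t" for x using bij by (auto simp: bij_betw_def)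
  have theta_0_scale: "\<theta> 0 = 0 \<cdot>\<^sub>v \<theta> 0" using scale[of 0 0] phi0[of 0] by simp
  have theta0: "\<theta> 0 = 0\<^sub>v t"
    by (subst theta_0_scale, intro eq_vecI) (use carrier_vecD[OF K] in auto)
  have inj: "\<theta> x = \<theta> y \<longleftrightarrow> x = y" for x y using bij by (auto simp: bij_betw_def inj_on_def)
  have nz: "\<theta> x \<noteq> 0\<^sub>v t \<longleftrightarrow> x \<noteq> 0" for x using inj[of x 0] theta0 by simp
  have surj: "\<exists>w. x = \<theta> w" if "x \<in> carrier_vec t" for x
    using bij that by (auto simp: bij_betw_def)
  have eq_iff: "pg_point t (\<theta> v) = pg_point t (\<theta> w) \<longleftrightarrow> pt v = pt w" if "v \<noteq> 0" "w \<noteq> 0" for v w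
  proof -
    have "pg_point t (\<theta> v) = pg_point t (\<theta> w) \<longleftrightarrow> (\<exists>c. c \<noteq> 0 \<and> v = \<phi> c * w)"
      unfolding pg_point_eq_iff[OF K K] scale[symmetric] inj ..
    also have "\<dots> \<longleftrightarrow> (\<exists>c\<in>Fq. v = c * w)"
      unfolding range[symmetric] using \<open>v \<noteq> 0\<close> phi0 by auto
    finally show ?thesis using pt_eq_iff_Fq[OF that] by simp
  qed
  \<comment> \<open>By \<open>eq_iff\<close> the image does not depend on the representative
    chosen.\<close>
  define f where "f P = pg_point t (\<theta> (SOME w. w \<noteq> 0 \<and> pt w = P))" for P
  have f: "f (pt w) = pg_point t (\<theta> w)" if "w \<noteq> 0" for w
  proof -
    have "(SOME v. v \<noteq> 0 \<and> pt v = pt w) \<noteq> 0 \<and> pt (SOME v. v \<noteq> 0 \<and> pt v = pt w) = pt w"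
      by (rule someI[of _ w]) (use that in simp)
    then show ?thesis unfolding f_def using eq_iff that by blast
  qed
  have "bij_betw f (subgeom q t) (pg_points t)"
    unfolding bij_betw_def
  proof
    show "inj_on f (subgeom q t)"
      unfolding subgeom_eq by (rule inj_onI) (auto simp: f eq_iff)
    have "pg_points t = {pg_point t (\<theta> w) | w. w \<noteq> 0}"
      unfolding pg_points_def using surj K nz by blast
    also have "\<dots> = f ` subgeom q t" unfolding subgeom_eq using f by (auto simp: image_iff)
    finally show "f ` subgeom q t = pg_points t" by simp
  qed
  moreover have "f ` block w w' = pg_span t {pg_point t (\<theta> w), pg_point t (\<theta> w')}"
    if ww: "w \<noteq> 0" "w' \<noteq> 0" "pt w \<noteq> pt w'" for w w'
  proof -
    have "f ` block w w' = {pg_point t (\<theta> x) | x. x \<in> Fq_span w w' \<and> x \<noteq> 0}"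
      unfolding block_eq_image[OF ww] using f by (auto simp: image_iff)
    also have "Fq_span w w' = {\<phi> a * w + \<phi> b * w' | a b. True}"
      unfolding Fq_span_def range[symmetric] by auto
    also have "{pg_point t (\<theta> x) | x. x \<in> {\<phi> a * w + \<phi> b * w' | a b. True} \<and> x \<noteq> 0}
        = {pg_point t (\<theta> (\<phi> a * w + \<phi> b * w')) | a b. \<theta> (\<phi> a * w + \<phi> b * w') \<noteq> 0\<^sub>v t}"
      unfolding nz by blast
    also have "\<dots> = pg_span t {pg_point t (\<theta> w), pg_point t (\<theta> w')}"
      unfolding add scale pg_span_two[OF K K] ..
    finally show ?thesis .
  qed
  note image_block = this
  have "(\<lambda>B. f ` B) ` H_blocks q t = pg_lines t"
  proof (intro equalityI subsetI)
    fix l assume "l \<in> (\<lambda>B. f ` B) ` H_blocks q t"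
    then obtain w w' where ww: "w \<noteq> 0" "w' \<noteq> 0" "pt w \<noteq> pt w'" "l = f ` block w w'"
      unfolding H_blocks_eq by blast
    have "pg_point t (\<theta> w) \<in> pg_points t" "pg_point t (\<theta> w') \<in> pg_points t"
      "pg_point t (\<theta> w) \<noteq> pg_point t (\<theta> w')"
      using ww(1-3) by (simp_all add: pg_points_iff[OF K] nz eq_iff)
    then show "l \<in> pg_lines t" unfolding pg_lines_def ww(4) image_block[OF ww(1-3)] by blast
  next
    fix l :: "'b vec set set" assume "l \<in> pg_lines t"
    then obtain x y where xy: "x \<in> carrier_vec t" "x \<noteq> 0\<^sub>v t" "y \<in> carrier_vec t" "y \<noteq> 0\<^sub>v t"
      "pg_point t x \<noteq> pg_point t y" "l = pg_span t {pg_point t x, pg_point t y}"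
      unfolding pg_lines_def pg_points_def by blast
    obtain w w' where w: "x = \<theta> w" "y = \<theta> w'" using surj xy(1,3) by blast
    then have ww: "w \<noteq> 0" "w' \<noteq> 0" "pt w \<noteq> pt w'" using xy nz eq_iff by auto
    have "l = f ` block w w'" unfolding image_block[OF ww] xy(6) w ..
    then show "l \<in> (\<lambda>B. f ` B) ` H_blocks q t" unfolding H_blocks_eq using ww by blast
  qed
  ultimately show ?thesis unfolding design_iso_def by blast
qed

end

theorem theorem2p4:
  fixes q t :: nat
  assumes "primepow q" and "t > 3"
    and "card (UNIV :: 'a::{field,finite} set) = q ^ t"
    and "card (UNIV :: 'b::{field,finite} set) = q"
  shows "is_2_design ((q ^ t - 1) div (q - 1)) (q + 1) 1
           (subgeom q t :: 'a vec set set) (H_blocks q t) \<and>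
         design_iso (subgeom q t :: 'a vec set set) (H_blocks q t)
           (pg_points t :: 'b vec set set) (pg_lines t)"
proof -
  interpret big_field q t "TYPE('a)" by unfold_locales (use assms in auto)
  obtain \<phi> :: "'b \<Rightarrow> 'a" where phi: "\<And>x y. \<phi> (x + y) = \<phi> x + \<phi> y"
    "\<And>x y. \<phi> (x * y) = \<phi> x * \<phi> y" "inj \<phi>" "range \<phi> = Fq"
    using ex_field_embedding[OF assms(1) _ assms(3,4)] assms(2) unfolding Fq_def by auto
  obtain \<theta> :: "'a \<Rightarrow> 'b vec" where theta: "bij_betw \<theta> UNIV (carrier_vec t)"
    "\<And>x y. \<theta> (x + y) = \<theta> x + \<theta> y" "\<And>c x. \<theta> (\<phi> c * x) = c \<cdot>\<^sub>v \<theta> x"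
    using ex_linear_bijection[OF assms(4) phi] by blast
  have "\<phi> 0 = 0" using phi(1)[of 0 0] by (metis add_0_right add_left_imp_eq)
  then have "\<phi> c = 0 \<longleftrightarrow> c = 0" for c using injD[OF phi(3), of c 0] by auto
  from is_2_design_H design_iso_H[OF phi(4) this theta] show ?thesis by blast
qed

end
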